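(* Let $\mathbb{P}$ be a Cantor set or the Baire space $\mathbb{R}\setminus\mathbb{Q}$ (with the subspace topology of $\mathbb{R}$). Then for every cardinal number $\kappa$ with $2\leq\kappa\leq\mathbf{c}$ the space $\mathbb{P}$ can be partitioned into exactly $\kappa$ homeomorphic Bernstein sets.
   Context: $\mathbf{c}=2^{\aleph_0}$. A Cantor set is a nonempty totally disconnected compact metrizable space without isolated points, equivalently a space homeomorphic to the Cantor ternary set. A subset $B$ of an uncountable Polish space $\mathbb{P}$ is a Bernstein set if and only if no Cantor set (i.e. no subset of $\mathbb{P}$ which, as a subspace, is a Cantor set) is contained in $B$ or in $\mathbb{P}\setminus B$. "Homeomorphic Bernstein sets" means that the members of the partition, as subspaces of $\mathbb{P}$, are all homeomorphic to each other. *)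

theory Defs
  imports "HOL-Analysis.Analysis" "HOL-Library.Disjoint_Sets"
begin

unbundle cardinal_syntax

definition totally_disconnected_space :: "'a topology \<Rightarrow> bool" where
  "totally_disconnected_space X \<longleftrightarrow>
     (\<forall>C x y. connectedin X C \<and> x \<in> C \<and> y \<in> C \<longrightarrow> x = y)"

definition cantor_space :: "'a topology \<Rightarrow> bool" where
  "cantor_space X \<longleftrightarrow>
     topspace X \<noteq> {} \<and> totally_disconnected_space X \<and> compact_space X \<and>
     metrizable_space X \<and> (\<forall>x\<in>topspace X. \<not> openin X {x})"

abbreviation baire_space :: "real topology" where
  "baire_space \<equiv> subtopology euclideanreal (UNIV - \<rat>)"

(* Intended for uncountable Polish spaces X; this standing assumption is not part of the
   definition. *)
definition bernstein_set :: "'a topology \<Rightarrow> 'a set \<Rightarrow> bool" where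
  "bernstein_set X B \<longleftrightarrow>
     B \<subseteq> topspace X \<and>
     (\<forall>C \<subseteq> topspace X. cantor_space (subtopology X C) \<longrightarrow>
        \<not> C \<subseteq> B \<and> \<not> C \<subseteq> topspace X - B)"

(* Cardinals are represented by cardinal orders r; being of cardinality exactly r is
   expressed by the order isomorphism relation =o. *)
definition partitionable_homeomorphic_bernstein :: "'a topology \<Rightarrow> 'k rel \<Rightarrow> bool" where
  "partitionable_homeomorphic_bernstein X r \<longleftrightarrow>
     (\<exists>\<B>. partition_on (topspace X) \<B> \<and> |\<B>| =o r \<and>
          (\<forall>B\<in>\<B>. bernstein_set X B) \<and>
          (\<forall>A\<in>\<B>. \<forall>B\<in>\<B>. subtopology X A homeomorphic_space subtopology X B))"

end

theory Submission
  imports Defs "HOL-Library.Z2" "HOL-Library.Function_Algebras"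
begin

text \<open>
  Every Cantor set is homeomorphic to \<open>F\<^sup>\<nat>\<close> for the field \<open>F\<close> with two elements, and by continued
  fractions the Baire space is homeomorphic to \<open>F\<^sup>\<nat>\<close> for \<open>F = \<rat>\<close>, where \<open>F\<close> is discrete. Now
  \<open>V = F\<^sup>\<nat>\<close> is a vector space over a countable field, it has continuum many Cantor subsets,
  and each of them has continuum many points. For any \<open>S \<subseteq> V\<close> a transfinite recursion therefore chooses
  points \<open>h (C, w) \<in> C\<close>, indexed by Cantor sets \<open>C\<close> and \<open>w \<in> span S\<close>, that are linearly independent.
  A linear map \<open>f : V \<rightarrow> span S\<close> with \<open>f (h (C, w)) = w\<close> has fibres that meet every Cantor set, and its
  fibres are translates of each other. For infinite \<open>\<kappa>\<close> take \<open>S\<close> of cardinality \<open>\<kappa>\<close>; then \<open>span S\<close> has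
  cardinality \<open>\<kappa>\<close> as well.

  For \<open>\<kappa> = n\<close> finite, the space is homeomorphic to \<open>n \<times> V\<close>. Collapsing the values of \<open>f\<close> gives a map \<open>g\<close> from
  \<open>V\<close> to \<open>{0, \<dots>, n - 1}\<close> whose fibres meet every Cantor set, and rotation of the first factor permutes
  the fibres of \<open>(i, x) \<mapsto> (i + g x) mod n\<close> transitively.
\<close>

section \<open>Coding of Cantor spaces by binary sequences\<close>

abbreviation sequence_space :: "(nat \<Rightarrow> 'f) topology" where
  "sequence_space \<equiv> product_topology (\<lambda>_. discrete_topology UNIV) UNIV"

text \<open>In a compact Hausdorff space a clopen set separates a point from a closed set whenever
  no connected set meets both (cut-wire fence theorem). Here connected sets have at most one
  point.\<close>

lemma totally_disconnected_clopen_nbhd: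
  assumes "compact_space X" "Hausdorff_space X" "totally_disconnected_space X"
    and "openin X U" "x \<in> U"
  obtains W where "openin X W" "closedin X W" "x \<in> W" "W \<subseteq> U"
proof -
  have x: "x \<in> topspace X"
    using assms openin_subset by blast
  have "separated_between X {x} (topspace X - U)"
  proof (rule cut_wire_fence_theorem)
    show "closedin X {x}"
      using x assms by (simp add: closedin_Hausdorff_singleton)
    show "disjnt C {x} \<or> disjnt C (topspace X - U)" if "connectedin X C" for C
      using that assms unfolding totally_disconnected_space_def disjnt_def by auto
  qed (use assms in auto)
  then obtain W where "closedin X W" "openin X W" "{x} \<subseteq> W" "topspace X - U \<subseteq> topspace X - W"
    by (auto simp: separated_between)
  moreover have "W \<subseteq> U"
    using calculation openin_subset by blast
  ultimately show ?thesis
    using that by blast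
qed

text \<open>For each \<open>n\<close>, compactness leaves finitely many clopen sets of radius at
  most \<open>1 / (n + 1)\<close> that cover the space. Together they form a countable family, and
  none of them contains two points whose distance is at least twice its radius.\<close>

lemma countable_clopen_separating:
  assumes "compact_space X" "metrizable_space X" "totally_disconnected_space X"
  obtains V :: "nat \<Rightarrow> 'a set" where
    "\<And>n. openin X (V n)" "\<And>n. closedin X (V n)"
    "\<And>x y. x \<in> topspace X \<Longrightarrow> y \<in> topspace X \<Longrightarrow> x \<noteq> y \<Longrightarrow> \<exists>n. x \<in> V n \<and> y \<notin> V n"
proof -
  obtain M d where "Metric_space M d" and X: "X = Metric_space.mtopology M d"
    using assms(2) unfolding metrizable_space_def by blast
  then interpret Metric_space M d by blast
  have "\<exists>\<F>. finite \<F> \<and> (\<forall>W\<in>\<F>. openin X W \<and> closedin X W \<and>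
          (\<exists>x\<in>M. W \<subseteq> mball x (inverse (real (Suc n))))) \<and> M \<subseteq> \<Union>\<F>" for n
  proof -
    define \<W> where "\<W> = {W. openin X W \<and> closedin X W \<and> (\<exists>x\<in>M. W \<subseteq> mball x (inverse (real (Suc n))))}"
    have "M \<subseteq> \<Union>\<W>"
    proof
      fix x assume x: "x \<in> M"
      obtain W where "openin X W" "closedin X W" "x \<in> W" "W \<subseteq> mball x (inverse (real (Suc n)))"
        using totally_disconnected_clopen_nbhd[of X "mball x (inverse (real (Suc n)))" x] assms x
        by (auto simp: X Hausdorff_space_mtopology)
      then show "x \<in> \<Union>\<W>"
        using x unfolding \<W>_def by auto
    qed
    then obtain \<F> where "finite \<F>" "\<F> \<subseteq> \<W>" "M \<subseteq> \<Union>\<F>"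
      using assms(1) unfolding compact_space_alt
      by (metis (no_types, lifting) X \<W>_def mem_Collect_eq topspace_mtopology)
    then show ?thesis
      unfolding \<W>_def by blast
  qed
  then obtain \<F> where fin: "\<And>n. finite (\<F> n)"
    and \<F>: "\<And>n W. W \<in> \<F> n \<Longrightarrow> openin X W \<and> closedin X W \<and> (\<exists>x\<in>M. W \<subseteq> mball x (inverse (real (Suc n))))"
    and cov: "\<And>n. M \<subseteq> \<Union>(\<F> n)"
    by metis
  \<comment> \<open>The empty set makes the family nonempty, so that \<open>from_nat_into\<close>
    enumerates exactly its members.\<close>
  define \<A> where "\<A> = insert {} (\<Union>n. \<F> n)"
  have "countable \<A>"
    unfolding \<A>_def using fin by (auto intro: countable_finite)
  have rng: "range (from_nat_into \<A>) = \<A>"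
    using \<open>countable \<A>\<close> by (simp add: \<A>_def)
  have clopen: "openin X W \<and> closedin X W" if "W \<in> \<A>" for W
    using that \<F> by (auto simp: \<A>_def)
  show ?thesis
  proof
    show "openin X (from_nat_into \<A> n)" "closedin X (from_nat_into \<A> n)" for n
      using clopen rng by blast+
    fix x y assume "x \<in> topspace X" "y \<in> topspace X" "x \<noteq> y"
    then have xy: "x \<in> M" "y \<in> M" "0 < d x y"
      by (auto simp: X)
    then obtain n where n: "inverse (real (Suc n)) < d x y / 2"
      using reals_Archimedean[of "d x y / 2"] by auto
    obtain W where W: "W \<in> \<F> n" "x \<in> W"
      using cov[of n] xy by blast
    obtain z where z: "z \<in> M" "W \<subseteq> mball z (inverse (real (Suc n)))"
      using \<F>[OF W(1)] by blast
    have "y \<notin> W"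
    proof
      assume "y \<in> W"
      then have "d z x < d x y / 2" "d z y < d x y / 2"
        using W z n by (auto simp: subset_iff)
      moreover have "d x y \<le> d z x + d z y"
        using triangle[of x z y] xy z by (simp add: commute)
      ultimately show False by simp
    qed
    moreover have "W \<in> range (from_nat_into \<A>)"
      using W rng by (auto simp: \<A>_def)
    ultimately show "\<exists>n. x \<in> from_nat_into \<A> n \<and> y \<notin> from_nat_into \<A> n"
      using W by blast
  qed
qed

text \<open>
  \<open>P U n\<close> is the piece of the clopen set \<open>U\<close> that is split off at stage \<open>n\<close>; \<open>T\<close> is the whole space.
\<close>

primrec binary_cell :: "('a set \<Rightarrow> nat \<Rightarrow> 'a set) \<Rightarrow> 'a set \<Rightarrow> (nat \<Rightarrow> bit) \<Rightarrow> nat \<Rightarrow> 'a set" where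
  "binary_cell P T s 0 = T"
| "binary_cell P T s (Suc n) =
     (if s n = 1 then P (binary_cell P T s n) n
      else binary_cell P T s n - P (binary_cell P T s n) n)"

text \<open>The same tree of cells, followed along a point instead of a given sequence. Reading the
  code off these cells avoids a simultaneous recursion for cell and code; \<open>bcell_code\<close>
  below links the two descriptions.\<close>

primrec point_cell :: "('a set \<Rightarrow> nat \<Rightarrow> 'a set) \<Rightarrow> 'a set \<Rightarrow> 'a \<Rightarrow> nat \<Rightarrow> 'a set" where
  "point_cell P T x 0 = T"
| "point_cell P T x (Suc n) =
     (if x \<in> P (point_cell P T x n) n then P (point_cell P T x n) n
      else point_cell P T x n - P (point_cell P T x n) n)"

text \<open>Splitting the space again and again into two nonempty clopen pieces yields a binary
  tree, and the code of a point records the branch through its cells. A continuous bijection from a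
  compact space onto a Hausdorff space is a homeomorphism.\<close>

lemma cantor_space_homeomorphic_sequence_space:
  assumes "cantor_space X"
  shows "X homeomorphic_space (sequence_space :: (nat \<Rightarrow> bit) topology)"
proof -
  define T where "T = topspace X"
  have ne: "T \<noteq> {}" and td: "totally_disconnected_space X" and cpt: "compact_space X"
    and met: "metrizable_space X" and perfect: "\<And>x. x \<in> T \<Longrightarrow> \<not> openin X {x}"
    using assms by (auto simp: cantor_space_def T_def)
  have haus: "Hausdorff_space X"
    using met by (rule metrizable_imp_Hausdorff_space)
  obtain V :: "nat \<Rightarrow> 'a set" where Vop: "\<And>n. openin X (V n)" and Vcl: "\<And>n. closedin X (V n)"
    and sep: "\<And>x y. x \<in> T \<Longrightarrow> y \<in> T \<Longrightarrow> x \<noteq> y \<Longrightarrow> \<exists>n. x \<in> V n \<and> y \<notin> V n"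
    using countable_clopen_separating[OF cpt met td] unfolding T_def by metis
  define clopen where "clopen U \<longleftrightarrow> openin X U \<and> closedin X U \<and> U \<noteq> {}" for U
  \<comment> \<open>Stage \<open>n\<close> splits along \<open>V n\<close> whenever that is possible, which makes the code injective;
    otherwise the absence of isolated points allows an arbitrary splitting, so that no cell is empty.\<close>
  have "\<exists>W. clopen U \<longrightarrow> clopen W \<and> W \<subseteq> U \<and> clopen (U - W) \<and>
            (U \<inter> V n \<noteq> {} \<and> U - V n \<noteq> {} \<longrightarrow> W = U \<inter> V n)" for U n
  proof (cases "U \<inter> V n \<noteq> {} \<and> U - V n \<noteq> {}")
    case True
    moreover have "U - U \<inter> V n = U - V n" by blast
    ultimately show ?thesis
      using Vop[of n] Vcl[of n]
      by (intro exI[of _ "U \<inter> V n"]) (auto simp: clopen_def openin_diff closedin_diff)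
  next
    case False
    show ?thesis
    proof (cases "clopen U")
      case True
      \<comment> \<open>An open singleton would be an isolated point, so \<open>U\<close> has a
        second point \<open>y\<close>. A clopen neighbourhood of \<open>x\<close> inside
        \<open>U\<close> that avoids \<open>y\<close> serves as the piece.\<close>
      then obtain x where x: "x \<in> U" "x \<in> T"
        unfolding clopen_def T_def using openin_subset by blast
      have "U \<noteq> {x}"
        using perfect x True by (auto simp: clopen_def)
      then obtain y where y: "y \<in> U" "y \<noteq> x"
        using x by blast
      have "openin X (U - {y})"
        using True y haus unfolding clopen_def
        by (meson closedin_Hausdorff_singleton openin_diff openin_subset subsetD)
      then obtain W where "openin X W" "closedin X W" "x \<in> W" "W \<subseteq> U - {y}"
        using totally_disconnected_clopen_nbhd[OF cpt haus td] x y by (metis DiffI singletonD)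
      with True False x y show ?thesis
        by (intro exI[of _ W]) (auto simp: clopen_def openin_diff closedin_diff)
    qed auto
  qed
  then obtain P where P: "\<And>U n. clopen U \<Longrightarrow> clopen (P U n) \<and> P U n \<subseteq> U \<and> clopen (U - P U n)"
    and PV: "\<And>U n. clopen U \<Longrightarrow> U \<inter> V n \<noteq> {} \<Longrightarrow> U - V n \<noteq> {} \<Longrightarrow> P U n = U \<inter> V n"
    by metis
  define cell where "cell = point_cell P T"
  define code where "code x n = (if x \<in> P (cell x n) n then 1 else 0 :: bit)" for x n
  have clopen_T: "clopen T"
    using ne by (auto simp: clopen_def T_def)
  have clopen_cell: "clopen (cell x n)" for x n
    unfolding cell_def by (induction n) (use clopen_T P in auto)
  have clopen_bcell: "clopen (binary_cell P T s n)" for s n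
    by (induction n) (use clopen_T P in auto)
  have in_cell: "x \<in> cell x n" if "x \<in> T" for x n
    unfolding cell_def by (induction n) (use that in auto)
  have cell_eq: "cell y n = cell x n" if "y \<in> cell x n" for x y n
    using that
  proof (induction n)
    case (Suc n)
    have "y \<in> cell x n"
      using Suc.prems P[OF clopen_cell[of x n], of n] by (auto simp: cell_def split: if_splits)
    then have "cell y n = cell x n" by (rule Suc.IH)
    then show ?case
      using Suc.prems by (auto simp: cell_def split: if_splits)
  qed (simp add: cell_def)
  \<comment> \<open>Digit \<open>n\<close> is decided by the split performed at stage
    \<open>n\<close>, so it is constant on cells of stage \<open>Suc n\<close>. As these are open,
    the code is continuous.\<close>
  have code_eq: "code y n = code x n" if "y \<in> cell x (Suc n)" for x y n
  proof -
    have "y \<in> cell x n"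
      using that P[OF clopen_cell[of x n], of n] by (auto simp: cell_def split: if_splits)
    then show ?thesis
      using that cell_eq[of y x n] by (auto simp: code_def cell_def split: if_splits)
  qed
  have bcell_code: "binary_cell P T (code x) n = cell x n" for x n
    by (induction n) (auto simp: cell_def code_def)
  have code_unique: "code x = s" if "\<And>n. x \<in> binary_cell P T s n" for x s
  proof -
    have eq: "cell x n = binary_cell P T s n" for n
    proof (induction n)
      case (Suc n)
      with that[of "Suc n"] show ?case
        by (auto simp: cell_def split: if_splits)
    qed (simp add: cell_def)
    show ?thesis
    proof
      fix n show "code x n = s n"
        using that[of "Suc n"] eq[of n] by (auto simp: code_def split: if_splits)
    qed
  qed
  have "continuous_map X (discrete_topology UNIV) (\<lambda>x. code x n)" for n
    unfolding continuous_map_def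
  proof (intro conjI allI impI)
    fix U :: "bit set"
    show "openin X {x \<in> topspace X. code x n \<in> U}"
    proof (subst openin_subopen, intro ballI)
      fix x assume x: "x \<in> {x \<in> topspace X. code x n \<in> U}"
      have op: "openin X (cell x (Suc n))"
        using clopen_cell[of x "Suc n"] by (simp only: clopen_def)
      have "cell x (Suc n) \<subseteq> {x \<in> topspace X. code x n \<in> U}"
      proof
        fix y assume y: "y \<in> cell x (Suc n)"
        then have "code y n \<in> U"
          using x code_eq[OF y] by simp
        then show "y \<in> {x \<in> topspace X. code x n \<in> U}"
          using y openin_subset[OF op] by blast
      qed
      then show "\<exists>W. openin X W \<and> x \<in> W \<and> W \<subseteq> {x \<in> topspace X. code x n \<in> U}"
        using op x in_cell[of x "Suc n"] by (auto simp: T_def)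
    qed
  qed auto
  then have cont: "continuous_map X sequence_space code"
    by (simp add: continuous_map_componentwise_UNIV)
  have inj: "inj_on code T"
  proof (rule inj_onI, rule ccontr)
    fix x y assume xy: "x \<in> T" "y \<in> T" "code x = code y" "x \<noteq> y"
    then obtain n where n: "x \<in> V n" "y \<notin> V n" using sep by blast
    have eq: "cell x n = cell y n"
      using bcell_code xy(3) by metis
    \<comment> \<open>Equal codes put \<open>x\<close> and \<open>y\<close> into the same cell of
      stage \<open>n\<close>. There \<open>V n\<close> separates them, so the split at this stage is
      along \<open>V n\<close> and the digits differ.\<close>
    have "P (cell x n) n = cell x n \<inter> V n"
      using n eq in_cell[OF xy(1), of n] in_cell[OF xy(2), of n] by (intro PV[OF clopen_cell]) auto
    then have "code x n = 1" "code y n = 0"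
      using n eq in_cell[OF xy(1), of n] by (auto simp: code_def)
    then show False
      using xy(3) by simp
  qed
  have "s \<in> code ` T" for s
  proof -
    \<comment> \<open>Nested nonempty closed cells of a compact space have a common point, and its
      code is \<open>s\<close>.\<close>
    have "decseq (binary_cell P T s)"
      by (rule decseq_SucI) (use P[OF clopen_bcell] in auto)
    then have "(\<Inter>n. binary_cell P T s n) \<noteq> {}"
      using clopen_bcell by (intro compact_space_imp_nest[OF cpt]) (auto simp: clopen_def)
    then obtain x where x: "\<And>n. x \<in> binary_cell P T s n" by blast
    then have "x \<in> T" using x[of 0] by simp
    then show ?thesis using code_unique[OF x] by blast
  qed
  then have "homeomorphic_map X sequence_space code"
    using cont inj cpt
    by (intro continuous_imp_homeomorphic_map) (auto simp: T_def Hausdorff_space_product_topology PiE_UNIV_domain)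
  then show ?thesis
    by (rule homeomorphic_map_imp_homeomorphic_space)
qed

section \<open>Continued fractions\<close>

text \<open>Its iterates are the complete quotients of the continued fraction of \<open>x\<close>;
  inversion conjugates it to the usual Gauss map \<open>frac (1 / t)\<close>. At integers the value
  is the default 0, but only irrational points matter.\<close>

definition gauss :: "real \<Rightarrow> real" where
  "gauss x = 1 / frac x"

definition cf_digit :: "real \<Rightarrow> nat \<Rightarrow> int" where
  "cf_digit x n = \<lfloor>(gauss ^^ n) x\<rfloor>"

text \<open>Digit 0 is the integer part and can be any integer; the later complete quotients exceed
  1, so their floors are positive.\<close>

definition cf_digits :: "nat \<Rightarrow> int set" where
  "cf_digits n = (if n = 0 then UNIV else {1..})"

lemma floor_plus_inverse_gauss: "x = of_int \<lfloor>x\<rfloor> + 1 / gauss x"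
  by (simp add: gauss_def frac_def)

lemma frac_irrational: "x \<notin> \<rat> \<Longrightarrow> frac x \<notin> \<rat>"
  unfolding frac_def by (metis Rats_add Rats_of_int diff_add_cancel)

lemma gauss_irrational: "x \<notin> \<rat> \<Longrightarrow> gauss x \<notin> \<rat>"
  unfolding gauss_def using frac_irrational[of x]
  by (metis Rats_inverse inverse_eq_divide inverse_inverse_eq)

lemma gauss_gt_1:
  assumes "x \<notin> \<rat>"
  shows "1 < gauss x"
proof -
  have "frac x \<noteq> 0"
    using frac_irrational[OF assms] by (metis Rats_0)
  then have "0 < frac x" "frac x < 1"
    using frac_ge_0[of x] frac_lt_1[of x] by auto
  then show ?thesis
    by (simp add: gauss_def)
qed

lemma gauss_funpow_irrational: "x \<notin> \<rat> \<Longrightarrow> (gauss ^^ n) x \<notin> \<rat>"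
  by (induction n) (auto simp: gauss_irrational)

lemma cf_digit_in: "x \<notin> \<rat> \<Longrightarrow> cf_digit x n \<in> cf_digits n"
  using gauss_gt_1[OF gauss_funpow_irrational[of x "n - 1"]]
  by (cases n) (auto simp: cf_digits_def cf_digit_def le_floor_iff)

lemma cf_digit_gauss: "cf_digit (gauss x) n = cf_digit x (Suc n)"
  by (simp add: cf_digit_def funpow_swap1)

lemma eventually_floor_eq_irrational:
  fixes x :: real
  assumes "x \<notin> \<rat>"
  shows "\<forall>\<^sub>F y in nhds x. \<lfloor>y\<rfloor> = \<lfloor>x\<rfloor>"
proof -
  have "x \<notin> \<int>" using assms Ints_subset_Rats by blast
  then show ?thesis
    using eventually_floor_eq[OF filterlim_ident] by blast
qed

lemma isCont_gauss:
  assumes "x \<notin> \<rat>"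
  shows "isCont gauss x"
proof -
  have "x - of_int \<lfloor>x\<rfloor> \<noteq> 0"
    using assms by (metis Rats_of_int eq_iff_diff_eq_0)
  then have "isCont (\<lambda>y. 1 / (y - of_int \<lfloor>x\<rfloor>)) x"
    by (intro continuous_intros) auto
  moreover have "\<forall>\<^sub>F y in nhds x. gauss y = 1 / (y - of_int \<lfloor>x\<rfloor>)"
    using eventually_floor_eq_irrational[OF assms]
    by eventually_elim (simp add: gauss_def frac_def)
  ultimately show ?thesis
    by (simp add: isCont_cong)
qed

lemma isCont_gauss_funpow: "x \<notin> \<rat> \<Longrightarrow> isCont (gauss ^^ n) x"
proof (induction n)
  case (Suc n)
  then show ?case
    using continuous_at_compose[of x "gauss ^^ n" gauss] isCont_gauss gauss_funpow_irrational
    by (auto simp: o_def)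
qed (simp add: id_def)

text \<open>At an irrational point the iterates of \<open>gauss\<close> are continuous with
  irrational values, and the floor is constant near such a value.\<close>

lemma continuous_map_cf_digit:
  "continuous_map baire_space (discrete_topology (cf_digits n)) (\<lambda>x. cf_digit x n)"
  unfolding continuous_map_def
proof (intro conjI allI impI)
  fix U :: "int set"
  let ?S = "{x \<in> topspace baire_space. cf_digit x n \<in> U}"
  show "openin baire_space ?S"
  proof (subst openin_subopen, intro ballI)
    fix x assume x: "x \<in> ?S"
    then have irr: "x \<notin> \<rat>" by auto
    have "((gauss ^^ n) \<longlongrightarrow> (gauss ^^ n) x) (nhds x)"
      using isCont_gauss_funpow[OF irr, of n] by (simp add: isCont_def tendsto_at_iff_tendsto_nhds)
    with eventually_floor_eq_irrational[OF gauss_funpow_irrational[OF irr]]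
    have "\<forall>\<^sub>F y in nhds x. \<lfloor>(gauss ^^ n) y\<rfloor> = \<lfloor>(gauss ^^ n) x\<rfloor>"
      by (rule eventually_compose_filterlim)
    then obtain T where T: "open T" "x \<in> T" "\<And>y. y \<in> T \<Longrightarrow> cf_digit y n = cf_digit x n"
      unfolding eventually_nhds cf_digit_def by blast
    have "openin baire_space (T - \<rat>)"
      unfolding openin_subtopology using T(1) by (intro exI[of _ T]) auto
    moreover have "y \<in> ?S" if "y \<in> T - \<rat>" for y
      using that x T(3)[of y] by simp
    ultimately show "\<exists>T. openin baire_space T \<and> x \<in> T \<and> T \<subseteq> ?S"
      using irr T(2) by blast
  qed
qed (auto simp: cf_digit_in)

text \<open>One step gives \<open>x - y = (v - u) / (u * v)\<close> with \<open>u\<close> and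
  \<open>v\<close> merely above 1, hence no uniform contraction. Over two steps the denominators
  become \<open>u * u' = a * u' + 1\<close> and \<open>v * v' = a * v' + 1\<close>, both at least
  2.\<close>

lemma gauss_two_step:
  assumes "x \<notin> \<rat>" "y \<notin> \<rat>" "cf_digit x 0 = cf_digit y 0" "cf_digit x 1 = cf_digit y 1"
  shows "\<bar>x - y\<bar> \<le> \<bar>gauss (gauss x) - gauss (gauss y)\<bar> / 4"
proof -
  define u v u' v' where "u = gauss x" and "v = gauss y" and "u' = gauss u" and "v' = gauss v"
  have irr: "u \<notin> \<rat>" "v \<notin> \<rat>"
    using assms gauss_irrational by (auto simp: u_def v_def)
  have gt: "1 < u" "1 < v" "1 < u'" "1 < v'"
    using gauss_gt_1 assms irr by (auto simp: u_def v_def u'_def v'_def)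
  define a :: real where "a = of_int \<lfloor>u\<rfloor>"
  have "1 \<le> \<lfloor>u\<rfloor>" using gt by (simp add: le_floor_iff)
  then have a: "1 \<le> a" by (simp add: a_def)
  have x: "x = of_int \<lfloor>x\<rfloor> + 1 / u" and y: "y = of_int \<lfloor>x\<rfloor> + 1 / v"
    using assms(3) floor_plus_inverse_gauss[of x] floor_plus_inverse_gauss[of y]
    by (auto simp: u_def v_def cf_digit_def)
  have u: "u = a + 1 / u'" and v: "v = a + 1 / v'"
    using assms(4) floor_plus_inverse_gauss[of u] floor_plus_inverse_gauss[of v]
    by (auto simp: u_def v_def u'_def v'_def a_def cf_digit_def)
  have uu: "u * u' = a * u' + 1" and vv: "v * v' = a * v' + 1"
    using gt by (simp_all add: u v field_simps)
  have "1 * 1 \<le> a * u'" "1 * 1 \<le> a * v'"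
    using a gt by (intro mult_mono; simp)+
  then have "2 \<le> u * u'" "2 \<le> v * v'"
    using uu vv by auto
  then have "2 * 2 \<le> (u * u') * (v * v')"
    by (intro mult_mono) auto
  then have four: "4 \<le> (u * u') * (v * v')" by simp
  have uv: "v - u = (u' - v') / (u' * v')"
    using gt by (simp add: u v field_simps)
  have "x - y = 1 / u - 1 / v"
    using x y by linarith
  also have "\<dots> = (v - u) / (u * v)"
    using gt by (simp add: field_simps)
  also have "\<dots> = (u' - v') / ((u * u') * (v * v'))"
    unfolding uv by (simp add: mult_ac)
  finally have "x - y = (u' - v') / ((u * u') * (v * v'))" .
  then have "\<bar>x - y\<bar> = \<bar>u' - v'\<bar> / \<bar>(u * u') * (v * v')\<bar>"
    by (simp only: abs_divide)
  also have "\<dots> = \<bar>u' - v'\<bar> / ((u * u') * (v * v'))"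
    using four by (subst abs_of_nonneg) auto
  also have "\<dots> \<le> \<bar>u' - v'\<bar> / 4"
    using four by (intro divide_left_mono) auto
  finally show ?thesis
    by (simp add: u'_def v'_def u_def v_def)
qed

text \<open>The \<open>2 * n + 1\<close> digits allow \<open>n\<close> double steps, each
  contracting by 1/4. The digit left over makes the integer parts agree, which bounds the last
  distance by 1.\<close>

lemma cf_digits_agree_imp_close:
  assumes "x \<notin> \<rat>" "y \<notin> \<rat>" "\<And>i. i \<le> 2 * n \<Longrightarrow> cf_digit x i = cf_digit y i"
  shows "\<bar>x - y\<bar> < (1 / 4) ^ n"
  using assms
proof (induction n arbitrary: x y)
  case 0
  then have "\<lfloor>x\<rfloor> = \<lfloor>y\<rfloor>" by (auto simp: cf_digit_def)
  then show ?case by simp linarith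
next
  case (Suc n)
  have "\<bar>gauss (gauss x) - gauss (gauss y)\<bar> < (1 / 4) ^ n"
    using Suc.prems by (intro Suc.IH) (auto simp: gauss_irrational cf_digit_gauss)
  moreover have "\<bar>x - y\<bar> \<le> \<bar>gauss (gauss x) - gauss (gauss y)\<bar> / 4"
    using Suc.prems by (intro gauss_two_step) auto
  ultimately show ?case by simp
qed

text \<open>For positive later digits these are the values of the finite continued fraction
  [a 0; a 1, ..., a n + t] with t in [0, 1]; they are closed so that compactness applies. Recursion
  at the head makes the shift of \<open>a\<close> match one step of \<open>gauss\<close>.\<close>

primrec cf_interval :: "nat \<Rightarrow> (nat \<Rightarrow> int) \<Rightarrow> real set" where
  "cf_interval 0 a = {of_int (a 0)..of_int (a 0) + 1}"
| "cf_interval (Suc n) a = (\<lambda>y. of_int (a 0) + 1 / y) ` cf_interval n (\<lambda>i. a (Suc i))"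

text \<open>Keeps the divisions in \<open>cf_interval\<close> away from zero.\<close>

lemma cf_interval_ge: "(\<And>i. 1 \<le> a i) \<Longrightarrow> y \<in> cf_interval n a \<Longrightarrow> 1 \<le> y"
proof (induction n arbitrary: a y)
  case 0
  have "(1::real) \<le> of_int (a 0)"
    using 0(1)[of 0] by simp
  then show ?case
    using 0(2) by simp
next
  case (Suc n)
  then obtain z where z: "z \<in> cf_interval n (\<lambda>i. a (Suc i))" "y = of_int (a 0) + 1 / z"
    by auto
  have "1 \<le> z"
    using Suc.IH[OF _ z(1)] Suc.prems(1) by auto
  moreover have "(1::real) \<le> of_int (a 0)"
    using Suc.prems(1)[of 0] by simp
  moreover have "0 \<le> 1 / z" using \<open>1 \<le> z\<close> by simp
  ultimately show ?case using z by linarith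
qed

text \<open>Both sides are images under the same map, so nesting is inherited from the shifted
  sequence. The endpoints, whose order flips at every level, need not be computed.\<close>

lemma cf_interval_subset:
  "(\<And>i. 1 \<le> a (Suc i)) \<Longrightarrow> cf_interval (Suc n) a \<subseteq> cf_interval n a"
proof (induction n arbitrary: a)
  case 0
  have "1 \<le> y" if "y \<in> {real_of_int (a (Suc 0))..real_of_int (a (Suc 0)) + 1}" for y
    using that 0[of 0] by auto
  then show ?case by force
next
  case (Suc n)
  have "cf_interval (Suc n) (\<lambda>i. a (Suc i)) \<subseteq> cf_interval n (\<lambda>i. a (Suc i))"
    by (rule Suc.IH) (rule Suc.prems)
  then show ?case
    unfolding cf_interval.simps(2)[of "Suc n" a] cf_interval.simps(2)[of n a]
    by (rule image_mono)
qed

lemma compact_cf_interval: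
  "(\<And>i. 1 \<le> a (Suc i)) \<Longrightarrow> compact (cf_interval n a) \<and> cf_interval n a \<noteq> {}"
proof (induction n arbitrary: a)
  case (Suc n)
  have "1 \<le> y" if "y \<in> cf_interval n (\<lambda>i. a (Suc i))" for y
    using cf_interval_ge[OF _ that] Suc.prems by auto
  then have "continuous_on (cf_interval n (\<lambda>i. a (Suc i))) (\<lambda>y. of_int (a 0) + 1 / y)"
    by (intro continuous_intros) fastforce
  then show ?case
    using Suc.IH[of "\<lambda>i. a (Suc i)"] Suc.prems by (auto intro: compact_continuous_image)
qed auto

text \<open>Writing \<open>x\<close> as \<open>a 0 + 1 / y\<close> moves a point of all intervals to
  a point of all shifted ones. The intervals are closed, so the strict upper bound takes a second
  step: the lower bound for the shifted point gives
  \<open>1 \<le> a 1 < 1 / (x - a 0)\<close>.\<close>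

lemma cf_interval_Inter_shift:
  assumes "\<And>i. 1 \<le> a (Suc i)" "\<And>n. x \<in> cf_interval n a"
  shows "of_int (a 0) < x" "x < of_int (a 0) + 1"
    "\<And>n. 1 / (x - of_int (a 0)) \<in> cf_interval n (\<lambda>i. a (Suc i))"
proof -
  have *: "of_int (a 0) < x \<and> 1 / (x - of_int (a 0)) \<in> cf_interval n (\<lambda>i. a (Suc i))"
    if a: "\<And>i. 1 \<le> a (Suc i)" and x: "\<And>n. x \<in> cf_interval n a" for a x n
  proof -
    obtain y where y: "y \<in> cf_interval n (\<lambda>i. a (Suc i))" "x = of_int (a 0) + 1 / y"
      using x[of "Suc n"] by auto
    moreover have "1 \<le> y"
      using cf_interval_ge[OF _ y(1)] a by auto
    ultimately show ?thesis by simp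
  qed
  from *[OF assms] show "of_int (a 0) < x" "\<And>n. 1 / (x - of_int (a 0)) \<in> cf_interval n (\<lambda>i. a (Suc i))"
    by auto
  then have "of_int (a (Suc 0)) < 1 / (x - of_int (a 0))"
    using *[of "\<lambda>i. a (Suc i)" "1 / (x - of_int (a 0))"] assms(1) by auto
  moreover have "(1::real) \<le> of_int (a (Suc 0))"
    using assms(1)[of 0] by simp
  ultimately have "1 < 1 / (x - of_int (a 0))"
    by linarith
  then show "x < of_int (a 0) + 1"
    using \<open>of_int (a 0) < x\<close> by (simp add: field_simps)
qed

lemma cf_interval_Inter_not_quotient:
  assumes "\<And>i. 1 \<le> a (Suc i)" "\<And>n. x \<in> cf_interval n a"
  shows "x \<noteq> of_int p / of_nat q"
  using assms \<comment> \<open>infinite descent: the continued fraction step strictly decreases the denominator\<close>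
proof (induction q arbitrary: a x p rule: less_induct)
  case (less q)
  note sh = cf_interval_Inter_shift[OF less.prems]
  show ?case
  proof
    assume x: "x = of_int p / of_nat q"
    define r where "r = p - a 0 * int q"
    \<comment> \<open>Division by zero gives 0, so the case \<open>q = 0\<close> would mean
      \<open>x = 0\<close>, which is not strictly between consecutive integers.\<close>
    have "q \<noteq> 0"
    proof
      assume "q = 0"
      then have "x = 0" using x by simp
      then have "of_int (a 0) < (0::real)" "(0::real) < of_int (a 0) + 1"
        using sh by auto
      then have "a 0 < 0" "0 < a 0 + 1" by linarith+
      then show False by linarith
    qed
    then have r: "x - of_int (a 0) = of_int r / of_nat q"
      by (simp add: x r_def field_simps)
    \<comment> \<open>The fractional part lies strictly between 0 and 1, so its numerator
      \<open>r\<close> is below \<open>q\<close>; in the reciprocal, \<open>r\<close> is the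
      denominator.\<close>
    then have "0 < real_of_int r" "real_of_int r < of_nat q"
      using sh(1,2) \<open>q \<noteq> 0\<close> by (simp_all add: field_simps x r_def)
    then have "nat r < q" "0 < r" by linarith+
    moreover have "1 / (x - of_int (a 0)) = of_int (int q) / of_nat (nat r)"
      using r \<open>0 < r\<close> by simp
    ultimately show False
      using less.IH[of "nat r" "\<lambda>i. a (Suc i)" "1 / (x - of_int (a 0))" "int q"] less.prems(1) sh(3)
      by blast
  qed
qed

text \<open>The strict bounds \<open>a 0 < x < a 0 + 1\<close> identify the floor, and then
  \<open>gauss x\<close> is exactly the shifted point, to which induction applies.\<close>

lemma cf_interval_Inter_cf_digit:
  assumes "\<And>i. 1 \<le> a (Suc i)" "\<And>n. x \<in> cf_interval n a"
  shows "cf_digit x n = a n"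
  using assms
proof (induction n arbitrary: a x)
  case 0
  then show ?case
    using cf_interval_Inter_shift[of a x] by (auto simp: cf_digit_def floor_eq_iff)
next
  case (Suc n)
  note sh = cf_interval_Inter_shift[OF Suc.prems]
  have "\<lfloor>x\<rfloor> = a 0"
    using sh by (auto simp: floor_eq_iff)
  then have "gauss x = 1 / (x - of_int (a 0))"
    by (simp add: gauss_def frac_def)
  then show ?case
    using Suc.IH[of "\<lambda>i. a (Suc i)" "gauss x"] Suc.prems(1) sh(3)
    by (simp flip: cf_digit_gauss)
qed

lemma cf_digit_surj:
  assumes "\<And>n. a n \<in> cf_digits n"
  obtains x where "x \<notin> \<rat>" "cf_digit x = a"
proof -
  have a: "1 \<le> a (Suc i)" for i
    using assms[of "Suc i"] by (simp add: cf_digits_def)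
  have "(\<Inter>n. cf_interval n a) \<noteq> {}"
  proof (rule compact_nest)
    show "cf_interval n a \<subseteq> cf_interval m a" if "m \<le> n" for m n
      using that lift_Suc_antimono_le[of "\<lambda>n. cf_interval n a"] cf_interval_subset[of a] a by blast
  qed (use compact_cf_interval a in auto)
  then obtain x where x: "\<And>n. x \<in> cf_interval n a" by blast
  have "x \<notin> \<rat>"
  proof
    assume "x \<in> \<rat>"
    then obtain p :: int and q :: nat where "x = of_int p / of_nat q"
      unfolding Rats_eq_int_div_nat by blast
    then show False
      using cf_interval_Inter_not_quotient[OF a x] by blast
  qed
  then show ?thesis
    using that cf_interval_Inter_cf_digit[OF a x] by blast
qed

text \<open>Numbers that agree in enough digits are close; this yields both injectivity and openness
  of the digit map.\<close>

lemma baire_space_homeomorphic_cf_digits: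
  "homeomorphic_map baire_space (product_topology (\<lambda>n. discrete_topology (cf_digits n)) UNIV) cf_digit"
    (is "homeomorphic_map _ ?Y _")
proof -
  have img: "cf_digit ` topspace baire_space = topspace ?Y"
  proof
    show "cf_digit ` topspace baire_space \<subseteq> topspace ?Y"
      by (auto simp: cf_digit_in PiE_UNIV_domain)
    show "topspace ?Y \<subseteq> cf_digit ` topspace baire_space"
    proof
      fix a assume "a \<in> topspace ?Y"
      then have "\<And>n. a n \<in> cf_digits n" by auto
      then obtain x where "x \<notin> \<rat>" "cf_digit x = a" by (rule cf_digit_surj)
      then show "a \<in> cf_digit ` topspace baire_space" by auto
    qed
  qed
  have close: "\<exists>n. \<forall>y. y \<notin> \<rat> \<longrightarrow> (\<forall>i\<le>n. cf_digit x i = cf_digit y i) \<longrightarrow> \<bar>x - y\<bar> < e"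
    if "x \<notin> \<rat>" "0 < e" for x e
  proof -
    obtain n where "(1 / 4) ^ n < e"
      using real_arch_pow_inv[OF \<open>0 < e\<close>, of "1 / 4"] by auto
    then show ?thesis
      using cf_digits_agree_imp_close[of x _ n] that by (intro exI[of _ "2 * n"]) force
  qed
  have inj: "inj_on cf_digit (topspace baire_space)"
  proof (rule inj_onI, rule ccontr)
    fix x y assume xy: "x \<in> topspace baire_space" "y \<in> topspace baire_space"
      "cf_digit x = cf_digit y" "x \<noteq> y"
    then show False
      using close[of x "\<bar>x - y\<bar>"] by auto
  qed
  have cont: "continuous_map baire_space ?Y cf_digit"
    using continuous_map_cf_digit by (simp add: continuous_map_componentwise_UNIV)
  have "open_map baire_space ?Y cf_digit"
    unfolding open_map_def
  proof (intro allI impI)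
    fix U assume U: "openin baire_space U"
    show "openin ?Y (cf_digit ` U)"
    proof (subst openin_subopen, intro ballI)
      fix a assume "a \<in> cf_digit ` U"
      then obtain x where x: "x \<in> U" "a = cf_digit x" by blast
      obtain T where T: "open T" "U = T - \<rat>"
        using U by (auto simp: openin_subtopology)
      then obtain e where e: "0 < e" "ball x e \<subseteq> T"
        using x open_contains_ball by (metis DiffD1)
      obtain n where n: "\<And>y. y \<notin> \<rat> \<Longrightarrow> (\<forall>i\<le>n. cf_digit x i = cf_digit y i) \<Longrightarrow> \<bar>x - y\<bar> < e"
        using close[of x e] x T e by blast
      \<comment> \<open>The cylinder of all admissible sequences that agree with \<open>a\<close> up
        to index \<open>n\<close>; it is basic open because only finitely many coordinates are
        restricted.\<close>
      define W where "W = (\<Pi>\<^sub>E i\<in>UNIV. if i \<le> n then {a i} else cf_digits i)"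
      have "openin ?Y W"
        unfolding W_def openin_PiE_gen
        using x T by (auto simp: openin_PiE_gen cf_digit_in)
      moreover have "a \<in> W"
        using x T by (auto simp: W_def cf_digit_in)
      moreover have "W \<subseteq> cf_digit ` U"
      proof
        fix b assume b: "b \<in> W"
        then have ba: "b i = a i" if "i \<le> n" for i
          using that by (auto simp: W_def PiE_iff split: if_splits)
        have "b \<in> topspace ?Y"
          using \<open>openin ?Y W\<close> b openin_subset by blast
        then obtain y where y: "y \<notin> \<rat>" "b = cf_digit y"
          unfolding img[symmetric] by auto
        then have "y \<in> ball x e"
          using n[of y] ba x by (simp add: dist_real_def)
        then show "b \<in> cf_digit ` U"
          using e T y by blast
      qed
      ultimately show "\<exists>W. openin ?Y W \<and> a \<in> W \<and> W \<subseteq> cf_digit ` U" by blast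
    qed
  qed
  then show ?thesis
    using cont inj img by (intro bijective_open_imp_homeomorphic_map) auto
qed

text \<open>The digits are relabelled coordinate by coordinate. Every digit set is countably
  infinite, and any bijection between discrete spaces is a homeomorphism.\<close>

lemma baire_space_homeomorphic_product:
  assumes "countable (UNIV :: 'f set)" "infinite (UNIV :: 'f set)"
  shows "baire_space homeomorphic_space
    (product_topology (\<lambda>_. discrete_topology UNIV) UNIV :: (nat \<Rightarrow> 'f) topology)"
proof -
  have "infinite (cf_digits n)" "countable (cf_digits n)" for n
    by (auto simp: cf_digits_def infinite_Ici)
  then have "\<exists>e. bij_betw e (cf_digits n) (UNIV :: 'f set)" for n
    using assms by (metis bij_betw_from_nat_into bij_betw_inv_into bij_betw_trans)
  then obtain e where e: "\<And>n. bij_betw (e n) (cf_digits n) (UNIV :: 'f set)"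
    by metis
  define e' where "e' n = inv_into (cf_digits n) (e n)" for n
  have e': "e' n b \<in> cf_digits n" "e n (e' n b) = b" for n b
    using e[of n] by (auto simp: e'_def bij_betw_def inv_into_into f_inv_into_f)
  have e'_e: "e' n (e n d) = d" if "d \<in> cf_digits n" for n d
    using e[of n] that by (auto simp: e'_def bij_betw_def)
  let ?Y = "product_topology (\<lambda>n. discrete_topology (cf_digits n)) UNIV"
  let ?Z = "product_topology (\<lambda>_. discrete_topology UNIV) UNIV :: (nat \<Rightarrow> 'f) topology"
  have "homeomorphic_maps ?Y ?Z (\<lambda>a n. e n (a n)) (\<lambda>b n. e' n (b n))"
    unfolding homeomorphic_maps_def
  proof (intro conjI ballI)
    show "continuous_map ?Y ?Z (\<lambda>a n. e n (a n))"
      unfolding continuous_map_componentwise_UNIV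
    proof
      fix n
      have "continuous_map (discrete_topology (cf_digits n)) (discrete_topology UNIV) (e n)"
        by simp
      then show "continuous_map ?Y (discrete_topology UNIV) (\<lambda>a. e n (a n))"
        using continuous_map_compose[OF continuous_map_product_projection[OF UNIV_I, of "\<lambda>n. discrete_topology (cf_digits n)" n]]
        unfolding o_def by blast
    qed
    show "continuous_map ?Z ?Y (\<lambda>b n. e' n (b n))"
      unfolding continuous_map_componentwise_UNIV
    proof
      fix n
      have "continuous_map (discrete_topology UNIV) (discrete_topology (cf_digits n)) (e' n)"
        using e' by auto
      then show "continuous_map ?Z (discrete_topology (cf_digits n)) (\<lambda>b. e' n (b n))"
        using continuous_map_compose[OF continuous_map_product_projection[OF UNIV_I, of "\<lambda>_. discrete_topology UNIV" n]]
        unfolding o_def by blast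
    qed
  qed (auto simp: e' e'_e PiE_iff)
  then have "?Y homeomorphic_space ?Z"
    by (auto simp: homeomorphic_space_def)
  then show ?thesis
    using baire_space_homeomorphic_cf_digits homeomorphic_map_imp_homeomorphic_space
      homeomorphic_space_trans by blast
qed

section \<open>Linear maps with prescribed fibres\<close>

lemma countable_ordLeq_infinite:
  assumes "countable A" "infinite Z"
  shows "|A| \<le>o |Z|"
proof -
  have "|A| \<le>o |UNIV :: nat set|"
    using assms(1) unfolding countable_def card_of_ordLeq[symmetric] by blast
  also have "|UNIV :: nat set| \<le>o |Z|"
    using assms(2) by (simp add: infinite_iff_card_of_nat)
  finally show ?thesis .
qed

lemma uncountable_ordLess:
  assumes "countable A" "uncountable B"
  shows "|A| <o |B|"
  by (metis assms card_of_ordLeq card_of_ordLess countable_image_inj_on countable_subset)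

context vector_space
begin

text \<open>Stage \<open>E n\<close> holds the sums of \<open>n\<close> scaled members of
  \<open>A\<close>. With countably many scalars each stage has size at most \<open>|Z|\<close>, and
  there are countably many stages. Keeping \<open>Z\<close> apart from \<open>A\<close> also covers
  finite \<open>A\<close>.\<close>

lemma card_of_span_ordLeq:
  assumes "countable (UNIV :: 'a set)" "infinite Z" "|A| \<le>o |Z|"
  shows "|span A| \<le>o |Z|"
proof -
  define E where "E n = ((\<lambda>S. (\<lambda>((c, a), v). scale c a + v) ` ((UNIV \<times> A) \<times> S)) ^^ n) {0}" for n
  have E_Suc: "E (Suc n) = (\<lambda>((c, a), v). scale c a + v) ` ((UNIV \<times> A) \<times> E n)" for n
    by (simp add: E_def)
  have "|E n| \<le>o |Z|" for n
  proof (induction n)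
    case 0
    show ?case
      unfolding E_def using assms(2) by (intro countable_ordLeq_infinite) auto
  next
    case (Suc n)
    have "|(UNIV :: 'a set) \<times> A| \<le>o |Z|"
      using assms countable_ordLeq_infinite[OF assms(1,2)]
      by (intro card_of_Times_ordLeq_infinite_Field) (auto simp: Field_card_of card_of_card_order_on)
    then have "|((UNIV :: 'a set) \<times> A) \<times> E n| \<le>o |Z|"
      using assms Suc
      by (intro card_of_Times_ordLeq_infinite_Field[of "|Z|" "UNIV \<times> A"])
        (auto simp: Field_card_of card_of_card_order_on)
    then show ?case
      unfolding E_Suc using card_of_image ordLeq_transitive by blast
  qed
  then have "|\<Union>n. E n| \<le>o |Z|"
    using assms by (intro card_of_UNION_ordLeq_infinite) (auto simp: infinite_iff_card_of_nat)
  moreover have "span A \<subseteq> (\<Union>n. E n)"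
  proof
    fix x assume "x \<in> span A"
    then show "x \<in> (\<Union>n. E n)"
    proof (induction rule: span_induct_alt)
      case base
      have "0 \<in> E 0" by (simp add: E_def)
      then show ?case by blast
    next
      case (step c x y)
      then obtain n where "y \<in> E n" by blast
      then have "scale c x + y \<in> E (Suc n)"
        unfolding E_Suc using step(1) by (force intro!: image_eqI[of _ _ "((c, x), y)"])
      then show ?case by blast
    qed
  qed
  ultimately show ?thesis
    using card_of_mono1 ordLeq_transitive by blast
qed

text \<open>Transfinite recursion along a cardinal order of \<open>J\<close>: proper initial
  segments are smaller than the whole space, hence so are the spans of the points chosen so far, and
  \<open>C j\<close> is too large to fit into such a span.\<close>

lemma independent_choice:
  assumes "countable (UNIV :: 'a set)" "uncountable (UNIV :: 'b set)"
    and J: "|J| \<le>o |UNIV :: 'b set|" and C: "\<And>j. j \<in> J \<Longrightarrow> |UNIV :: 'b set| \<le>o |C j|"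
  obtains h where "\<And>j. j \<in> J \<Longrightarrow> h j \<in> C j" "inj_on h J" "independent (h ` J)"
proof -
  define r where "r = |J|"
  have wo: "well_order_on J r"
    unfolding r_def using card_of_well_order_on by blast
  then have wf: "wf (r - Id)" and tot: "total_on J r" and trans: "trans r"
    and fld: "Field r = J" and refl: "refl_on J r"
    by (auto simp: well_order_on_def linear_order_on_def partial_order_on_def preorder_on_def
        r_def Field_card_of)
  define F where "F f j = (SOME x. x \<in> C j \<and> x \<notin> span (f ` underS r j))" for f :: "_ \<Rightarrow> 'b" and j
  define h where "h = wfrec (r - Id) F"
  have h: "h j = F h j" for j
  proof -
    \<comment> \<open>\<open>F\<close> consults its first argument only on
      \<open>underS r j\<close>, where the cut changes nothing.\<close>
    have "h j = F (cut h (r - Id) j) j"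
      unfolding h_def by (rule wfrec[OF wf])
    also have "cut h (r - Id) j ` underS r j = h ` underS r j"
      by (rule image_cong) (auto simp: underS_def cut_def)
    then have "F (cut h (r - Id) j) j = F h j"
      by (simp add: F_def)
    finally show ?thesis .
  qed
  have h_prop: "h j \<in> C j \<and> h j \<notin> span (h ` underS r j)" if j: "j \<in> J" for j
  proof -
    have "|underS r j| <o r"
      using j fld unfolding r_def by (intro card_of_underS) (auto simp: card_of_card_order_on Field_card_of)
    then have less: "|underS r j| <o |UNIV :: 'b set|"
      using J unfolding r_def by (rule ordLess_ordLeq_trans)
    have "|span (h ` underS r j)| <o |UNIV :: 'b set|"
    \<comment> \<open>The span over a finite segment may be larger than the segment, but it is
      countable while the space is not; an infinite segment bounds the size of its span.\<close>
    proof (cases "finite (underS r j)")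
      case True
      then have "|span (h ` underS r j)| \<le>o |UNIV :: nat set|"
        using assms(1) by (intro card_of_span_ordLeq countable_ordLeq_infinite) (auto intro: countable_finite)
      also have "|UNIV :: nat set| <o |UNIV :: 'b set|"
        using assms(2) by (intro uncountable_ordLess) auto
      finally show ?thesis .
    next
      case False
      then have "|span (h ` underS r j)| \<le>o |underS r j|"
        using assms(1) by (intro card_of_span_ordLeq card_of_image)
      then show ?thesis
        using less by (rule ordLeq_ordLess_trans)
    qed
    then have "\<not> C j \<subseteq> span (h ` underS r j)"
      using C[OF j] by (meson card_of_mono1 not_ordLess_ordLeq ordLeq_transitive)
    then have "\<exists>x. x \<in> C j \<and> x \<notin> span (h ` underS r j)" by blast
    then show ?thesis
      unfolding h[of j] F_def by (rule someI_ex)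
  qed
  have "inj_on h J"
  proof (rule inj_onI, rule ccontr)
    fix j k assume jk: "j \<in> J" "k \<in> J" "h j = h k" "j \<noteq> k"
    then have "j \<in> underS r k \<or> k \<in> underS r j"
      using tot by (auto simp: total_on_def underS_def)
    then show False
      using h_prop[OF jk(1)] h_prop[OF jk(2)] jk(3) span_base by (metis imageI)
  qed
  \<comment> \<open>Remove the \<open>r\<close>-greatest index \<open>m\<close> of \<open>K\<close>:
    its vector was chosen outside the span of all earlier ones.\<close>
  have fin_indep: "independent (h ` K)" if "finite K" "K \<subseteq> J" for K
    using that
  proof (induction K rule: finite_psubset_induct)
    case (psubset K)
    show ?case
    proof (cases "K = {}")
      case False
      have "\<exists>m\<in>K. \<forall>k\<in>K. (k, m) \<in> r"
        using psubset.hyps False psubset.prems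
      proof (induction K rule: finite_ne_induct)
        case (singleton x)
        then show ?case using refl by (auto simp: refl_on_def)
      next
        case (insert x K)
        then obtain m where m: "m \<in> K" "\<forall>k\<in>K. (k, m) \<in> r" by auto
        have "(x, m) \<in> r \<or> (m, x) \<in> r"
          using tot refl insert.prems m(1) by (metis insert_subset refl_onD subsetD total_on_def)
        then show ?case
        proof
          assume "(x, m) \<in> r"
          then show ?thesis using m by blast
        next
          assume "(m, x) \<in> r"
          then have "\<forall>k\<in>K. (k, x) \<in> r"
            using m(2) trans by (meson transD)
          moreover have "(x, x) \<in> r"
            using refl insert.prems by (simp add: refl_onD)
          ultimately show ?thesis by blast
        qed
      qed
      then obtain m where m: "m \<in> K" "\<And>k. k \<in> K \<Longrightarrow> (k, m) \<in> r" by blast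
      have "h ` (K - {m}) \<subseteq> h ` underS r m"
        using m by (auto simp: underS_def)
      then have "h m \<notin> span (h ` (K - {m}))"
        using h_prop[of m] m psubset.prems span_mono by blast
      moreover have "independent (h ` (K - {m}))"
        using m psubset.prems by (intro psubset.IH) auto
      ultimately have "independent (insert (h m) (h ` (K - {m})))"
        by (rule independent_insertI)
      also have "insert (h m) (h ` (K - {m})) = h ` K"
        using m by blast
      finally show ?thesis .
    qed (simp add: independent_empty)
  qed
  have "independent (h ` J)"
  proof
    assume "dependent (h ` J)"
    then obtain t u where t: "finite t" "t \<subseteq> h ` J" "(\<Sum>v\<in>t. scale (u v) v) = 0" "\<exists>v\<in>t. u v \<noteq> 0"
      unfolding dependent_explicit by blast
    then have "dependent t"
      unfolding dependent_explicit by blast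
    moreover obtain K where "finite K" "K \<subseteq> J" "t = h ` K"
      using finite_subset_image[OF t(1,2)] by blast
    ultimately show False
      using fin_indep by blast
  qed
  then show ?thesis
    using that h_prop \<open>inj_on h J\<close> by blast
qed

text \<open>Every pair \<open>(C, w)\<close> gets its own vector in \<open>C\<close>, all of them
  independent, so the value \<open>w\<close> can be prescribed there. The number of pairs is at most
  that of all vectors, and the extension can be chosen with range the span of the prescribed
  values.\<close>

lemma linear_map_fibres_meet:
  assumes "countable (UNIV :: 'a set)" "uncountable (UNIV :: 'b set)"
    and \<C>: "|\<C>| \<le>o |UNIV :: 'b set|" and C: "\<And>C. C \<in> \<C> \<Longrightarrow> |UNIV :: 'b set| \<le>o |C|"
  obtains f where "Vector_Spaces.linear scale scale f" "range f = span S"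
    "\<And>C w. C \<in> \<C> \<Longrightarrow> w \<in> span S \<Longrightarrow> \<exists>x\<in>C. f x = w"
proof -
  interpret vector_space_pair scale scale ..
  \<comment> \<open>\<open>UNIV\<close> is added only to make the index set nonempty, so that the range is all of \<open>span S\<close>\<close>
  define \<C>' where "\<C>' = insert UNIV \<C>"
  have inf: "infinite (UNIV :: 'b set)"
    using assms(2) countable_finite by blast
  have "|\<C>'| \<le>o |UNIV :: 'b set|"
    unfolding \<C>'_def insert_is_Un[of UNIV \<C>] using \<C> inf
    by (intro card_of_Un_ordLeq_infinite_Field[OF _ countable_ordLeq_infinite])
      (auto simp: Field_card_of card_of_card_order_on)
  then have "|\<C>' \<times> span S| \<le>o |UNIV :: 'b set|"
    using inf by (intro card_of_Times_ordLeq_infinite_Field)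
      (auto simp: Field_card_of card_of_card_order_on intro: card_of_mono1)
  moreover have "|UNIV :: 'b set| \<le>o |fst j|" if "j \<in> \<C>' \<times> span S" for j
    using that C by (auto simp: \<C>'_def intro: card_of_mono1)
  ultimately obtain h where h: "\<And>j. j \<in> \<C>' \<times> span S \<Longrightarrow> h j \<in> fst j"
      "inj_on h (\<C>' \<times> span S)" "independent (h ` (\<C>' \<times> span S))"
    using independent_choice[OF assms(1,2)] by (metis (no_types, lifting))
  define J where "J = \<C>' \<times> span S"
  \<comment> \<open>As \<open>h\<close> is injective, \<open>inv_into J h\<close> recovers the pair
    from its vector, and \<open>snd\<close> is the value prescribed for it.\<close>
  obtain f where f: "Vector_Spaces.linear scale scale f"
      "\<forall>x\<in>h ` J. f x = snd (inv_into J h x)"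
      "range f = span ((\<lambda>x. snd (inv_into J h x)) ` (h ` J))"
    using linear_independent_extend_subspace[OF h(3), of "\<lambda>x. snd (inv_into J h x)"]
    unfolding J_def by blast
  have fh: "f (h (C, w)) = w" if "C \<in> \<C>'" "w \<in> span S" for C w
    using f(2) that h(2) by (auto simp: J_def inv_into_f_f)
  have "(\<lambda>x. snd (inv_into J h x)) ` (h ` J) = snd ` J"
    using h(2) by (auto simp: J_def image_image inv_into_f_f intro!: image_cong)
  also have "snd ` J = span S"
    by (force simp: J_def \<C>'_def)
  finally have "range f = span S"
    using f(3) by (simp add: span_span)
  moreover have "\<exists>x\<in>C. f x = w" if "C \<in> \<C>" "w \<in> span S" for C w
    using h(1)[of "(C, w)"] fh[of C w] that by (auto simp: \<C>'_def)
  ultimately show ?thesis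
    using that f(1) by blast
qed

end

section \<open>Homeomorphic Bernstein partitions\<close>

lemma homeomorphic_cantor_space:
  assumes "cantor_space X" "X homeomorphic_space Y"
  shows "cantor_space Y"
proof -
  obtain f g where fg: "homeomorphic_maps X Y f g"
    using assms(2) by (auto simp: homeomorphic_space_def)
  then have f: "homeomorphic_map X Y f"
    using homeomorphic_maps_map by blast
  from fg have g: "continuous_map Y X g" and fgy: "\<And>y. y \<in> topspace Y \<Longrightarrow> f (g y) = y"
    by (auto simp: homeomorphic_maps_def)
  then have gf: "g y \<in> topspace X \<and> f (g y) = y" if "y \<in> topspace Y" for y
    using that continuous_map_image_subset_topspace by fastforce
  have "topspace Y \<noteq> {}" "compact_space Y" "metrizable_space Y"
    using assms(1) homeomorphic_empty_space[OF assms(2)] homeomorphic_compact_space[OF assms(2)]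
      homeomorphic_metrizable_space[OF assms(2)] by (auto simp: cantor_space_def)
  moreover have "totally_disconnected_space Y"
    unfolding totally_disconnected_space_def
  proof (intro allI impI; elim conjE)
    fix C x y assume C: "connectedin Y C" "x \<in> C" "y \<in> C"
    then have "connectedin X (g ` C)"
      using connectedin_continuous_map_image[OF g] by blast
    then have "g x = g y"
      using C assms(1) unfolding cantor_space_def totally_disconnected_space_def by blast
    moreover have "x \<in> topspace Y" "y \<in> topspace Y"
      using C connectedin_subset_topspace by blast+
    ultimately show "x = y"
      using gf by metis
  qed
  moreover have "\<not> openin Y {y}" if y: "y \<in> topspace Y" for y
  proof
    assume "openin Y {y}"
    then have "openin X {g y}"
      using homeomorphic_map_openness[OF f, of "{g y}"] gf[OF y] by simp
    then show False
      using assms(1) gf[OF y] by (auto simp: cantor_space_def)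
  qed
  ultimately show ?thesis
    by (auto simp: cantor_space_def)
qed

text \<open>Closedness preserves compactness, and openness prevents new isolated points. Later it
  cuts a Cantor set in a product down to a single slice.\<close>

lemma cantor_space_clopen_subtopology:
  assumes "cantor_space X" "openin X U" "closedin X U" "U \<noteq> {}"
  shows "cantor_space (subtopology X U)"
proof -
  have "U \<subseteq> topspace X"
    using assms(2) openin_subset by blast
  then show ?thesis
    using assms closedin_compact_space[of X U]
    unfolding cantor_space_def totally_disconnected_space_def
    by (auto simp: metrizable_space_subtopology connectedin_subtopology openin_open_subtopology
        compact_space_subtopology subset_iff)
qed

text \<open>Together with the coding by binary sequences this makes finitely many copies of a Cantor
  space homeomorphic to one copy. Connected sets project to points in both factors, and the open
  second projection would turn an isolated point into one of \<open>X\<close>.\<close>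

lemma cantor_space_discrete_times:
  assumes "cantor_space X" "finite A" "A \<noteq> {}"
  shows "cantor_space (prod_topology (discrete_topology A) X)" (is "cantor_space ?Y")
proof -
  have "totally_disconnected_space ?Y"
    unfolding totally_disconnected_space_def
  proof (intro allI impI; elim conjE)
    fix C x y assume C: "connectedin ?Y C" "x \<in> C" "y \<in> C"
    have "connectedin (discrete_topology A) (fst ` C)" "connectedin X (snd ` C)"
      using connectedin_continuous_map_image[OF continuous_map_fst C(1)]
        connectedin_continuous_map_image[OF continuous_map_snd C(1)] by auto
    then obtain a where "fst ` C \<subseteq> {a}" "snd x = snd y"
      using C assms(1) unfolding cantor_space_def totally_disconnected_space_def
      by (metis connectedin_discrete_topology imageI)
    then show "x = y"
      using C by (auto simp: prod_eq_iff)
  qed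
  moreover have "\<not> openin ?Y {p}" if "p \<in> topspace ?Y" for p
  proof
    assume "openin ?Y {p}"
    then have "openin X (snd ` {p})"
      using open_map_snd unfolding open_map_def by blast
    then show False
      using assms(1) that by (auto simp: cantor_space_def)
  qed
  ultimately show ?thesis
    using assms unfolding cantor_space_def
    by (auto simp: compact_space_prod_topology compact_space_discrete_topology
        metrizable_space_prod_topology)
qed

lemma card_of_cantor_space:
  assumes "cantor_space X"
  shows "|topspace X| =o |UNIV :: (nat \<Rightarrow> bit) set|"
proof -
  obtain f where "homeomorphic_map X (sequence_space :: (nat \<Rightarrow> bit) topology) f"
    using cantor_space_homeomorphic_sequence_space[OF assms] homeomorphic_space by blast
  then have "bij_betw f (topspace X) (UNIV :: (nat \<Rightarrow> bit) set)"
    by (auto simp: homeomorphic_eq_everything_map bij_betw_def PiE_UNIV_domain)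
  then show ?thesis
    by (rule card_of_ordIsoI)
qed

text \<open>Reduces the task to finding a map that takes all values on every Cantor set. Such a set
  meets each fibre, so it misses none, and since a second value exists it lies in none.\<close>

lemma partitionable_homeomorphic_bernsteinI:
  fixes g :: "'a \<Rightarrow> 'k" and r :: "'r rel"
  assumes "|K| =o r" "k0 \<in> K" "k1 \<in> K" "k0 \<noteq> k1"
    and g: "g ` topspace X = K"
    and meets: "\<And>C k. C \<subseteq> topspace X \<Longrightarrow> cantor_space (subtopology X C) \<Longrightarrow> k \<in> K \<Longrightarrow> \<exists>x\<in>C. g x = k"
    and homeo: "\<And>k l. k \<in> K \<Longrightarrow> l \<in> K \<Longrightarrow>
      subtopology X {x \<in> topspace X. g x = k} homeomorphic_space subtopology X {x \<in> topspace X. g x = l}"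
  shows "partitionable_homeomorphic_bernstein X r"
proof -
  define B where "B k = {x \<in> topspace X. g x = k}" for k
  have ne: "B k \<noteq> {}" if "k \<in> K" for k
    using that g by (auto simp: B_def)
  have "inj_on B K"
    using ne by (force simp: inj_on_def B_def)
  then have "|B ` K| =o |K|"
    by (intro ordIso_symmetric[OF card_of_ordIsoI[of B]]) (auto simp: bij_betw_def)
  then have "|B ` K| =o r"
    using assms(1) ordIso_transitive by blast
  moreover have "partition_on (topspace X) (B ` K)"
    using g ne by (auto simp: partition_on_def disjoint_def B_def)
  moreover have "bernstein_set X (B k)" if k: "k \<in> K" for k
    unfolding bernstein_set_def
  proof (intro conjI allI impI)
    fix C assume C: "C \<subseteq> topspace X" "cantor_space (subtopology X C)"
    obtain l where "l \<in> K" "l \<noteq> k"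
      using assms(2-4) by blast
    then obtain x y where "x \<in> C" "g x = k" "y \<in> C" "g y = l"
      using meets[OF C] k by meson
    then show "\<not> C \<subseteq> B k" "\<not> C \<subseteq> topspace X - B k"
      using C(1) \<open>l \<noteq> k\<close> by (auto simp: B_def subset_iff)
  qed (auto simp: B_def)
  moreover have "\<forall>S\<in>B ` K. \<forall>T\<in>B ` K. subtopology X S homeomorphic_space subtopology X T"
    using homeo by (auto simp: B_def)
  ultimately show ?thesis
    unfolding partitionable_homeomorphic_bernstein_def by blast
qed

text \<open>Lets partitions be built on models made from sequence spaces. Pulling a Cantor set of
  \<open>Y\<close> back along \<open>h\<close> gives one of \<open>X\<close>, to which the Bernstein
  property applies.\<close>

lemma homeomorphic_partitionable_homeomorphic_bernstein:
  fixes r :: "'r rel"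
  assumes "X homeomorphic_space Y" "partitionable_homeomorphic_bernstein X r"
  shows "partitionable_homeomorphic_bernstein Y r"
proof -
  obtain h where h: "homeomorphic_map X Y h"
    using assms(1) homeomorphic_space by blast
  then have inj: "inj_on h (topspace X)" and img: "h ` topspace X = topspace Y"
    by (auto simp: homeomorphic_eq_everything_map)
  obtain \<B> where part: "partition_on (topspace X) \<B>" and card: "|\<B>| =o r"
    and bern: "\<And>B. B \<in> \<B> \<Longrightarrow> bernstein_set X B"
    and homeo: "\<And>A B. A \<in> \<B> \<Longrightarrow> B \<in> \<B> \<Longrightarrow> subtopology X A homeomorphic_space subtopology X B"
    using assms(2) unfolding partitionable_homeomorphic_bernstein_def by blast
  have sub: "subtopology X A homeomorphic_space subtopology Y (h ` A)" if "A \<subseteq> topspace X" for A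
    using homeomorphic_map_subtopologies[OF h, of A "h ` A"] that img
    by (metis (no_types, lifting) homeomorphic_map_imp_homeomorphic_space image_mono inf.absorb2)
  have \<B>_sub: "B \<subseteq> topspace X" if "B \<in> \<B>" for B
    using part that by (auto simp: partition_on_def)
  have inj_\<B>: "inj_on ((`) h) \<B>"
    using inj \<B>_sub by (meson inj_onI inj_on_image_eq_iff)
  have "|(`) h ` \<B>| =o |\<B>|"
    using inj_\<B> by (intro ordIso_symmetric[OF card_of_ordIsoI[of "(`) h"]]) (auto simp: bij_betw_def)
  then have "|(`) h ` \<B>| =o r"
    using card ordIso_transitive by blast
  moreover have "partition_on (topspace Y) ((`) h ` \<B>)"
    unfolding partition_on_def
  proof (intro conjI)
    show "\<Union> ((`) h ` \<B>) = topspace Y"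
      using part img by (metis image_Union partition_on_def)
    show "disjoint ((`) h ` \<B>)"
    proof (rule disjointI)
      fix a b assume "a \<in> (`) h ` \<B>" "b \<in> (`) h ` \<B>" "a \<noteq> b"
      then obtain A B where AB: "A \<in> \<B>" "B \<in> \<B>" "a = h ` A" "b = h ` B" "A \<noteq> B" by blast
      then have "A \<inter> B = {}"
        using part by (auto simp: partition_on_def disjoint_def)
      then show "a \<inter> b = {}"
        using AB inj \<B>_sub inj_on_image_Int[of h "topspace X" A B] by simp
    qed
    show "{} \<notin> (`) h ` \<B>"
      using part by (auto simp: partition_on_def)
  qed
  moreover have "bernstein_set Y (h ` B)" if B: "B \<in> \<B>" for B
    unfolding bernstein_set_def
  proof (intro conjI allI impI)
    show "h ` B \<subseteq> topspace Y"
      using \<B>_sub[OF B] img by blast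
    fix C assume C: "C \<subseteq> topspace Y" "cantor_space (subtopology Y C)"
    define D where "D = {x \<in> topspace X. h x \<in> C}"
    have D: "D \<subseteq> topspace X" "h ` D = C"
      using C(1) img by (auto simp: D_def)
    then have "cantor_space (subtopology X D)"
      using C(2) sub[OF D(1)] homeomorphic_cantor_space homeomorphic_space_sym by metis
    then have "\<not> D \<subseteq> B" "\<not> D \<subseteq> topspace X - B"
      using bern[OF B] D(1) by (auto simp: bernstein_set_def)
    then obtain x y where "x \<in> D" "x \<notin> B" "y \<in> D" "y \<in> B"
      using D(1) by blast
    moreover have "h x \<notin> h ` B"
      using calculation inj D(1) \<B>_sub[OF B] by (meson inj_on_image_mem_iff subsetD)
    ultimately show "\<not> C \<subseteq> h ` B" "\<not> C \<subseteq> topspace Y - h ` B"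
      using D(2) by blast+
  qed
  moreover have "subtopology Y (h ` A) homeomorphic_space subtopology Y (h ` B)"
    if "A \<in> \<B>" "B \<in> \<B>" for A B
    using homeo[OF that] sub \<B>_sub that homeomorphic_space_sym homeomorphic_space_trans by metis
  ultimately show ?thesis
    unfolding partitionable_homeomorphic_bernstein_def by blast
qed

section \<open>Cardinalities of sequence spaces and of their families of closed sets\<close>

lemma card_of_sequences_ordLeq:
  assumes "countable (UNIV :: 'f set)"
  shows "|UNIV :: (nat \<Rightarrow> 'f) set| \<le>o |UNIV :: (nat \<Rightarrow> bit) set|"
proof -
  obtain e :: "nat \<times> 'f \<Rightarrow> nat" where e: "inj e"
    using assms by (metis countableE countable_SIGMA UNIV_Times_UNIV countableI_type)
  \<comment> \<open>the indicator of the graph of \<open>x\<close>\<close>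
  define G where "G x m = (if m \<in> e ` {(n, x n) | n. True} then 1 else 0 :: bit)" for x m
  have "inj G"
  proof (rule injI, rule ext)
    fix x y n assume "G x = G y"
    then have "G y (e (n, x n)) = 1"
      by (metis (mono_tags, lifting) G_def imageI mem_Collect_eq)
    then have "e (n, x n) \<in> e ` {(n, y n) | n. True}"
      by (auto simp: G_def split: if_splits)
    then show "x n = y n"
      using e by (auto simp: inj_def)
  qed
  then show ?thesis
    by (intro card_of_ordLeqI[of G]) auto
qed

lemma card_of_binary_sequences_ordLeq:
  "|UNIV :: (nat \<Rightarrow> bit) set| \<le>o |UNIV :: (nat \<Rightarrow> 'f::zero_neq_one) set|"
proof (rule card_of_ordLeqI)
  show "inj (\<lambda>(x :: nat \<Rightarrow> bit) n. if x n = 1 then 1 else 0 :: 'f)"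
    by (auto simp: inj_def fun_eq_iff split: if_splits) (metis bit_not_one_iff)
qed auto

lemma uncountable_sequences: "uncountable (UNIV :: (nat \<Rightarrow> 'f::zero_neq_one) set)"
proof
  assume "countable (UNIV :: (nat \<Rightarrow> 'f) set)"
  then have "|UNIV :: (nat \<Rightarrow> 'f) set| \<le>o |UNIV :: nat set|"
    by (intro countable_ordLeq_infinite) auto
  also have "|UNIV :: nat set| <o |UNIV :: nat set set|"
    using card_of_Pow[of "UNIV :: nat set"] by simp
  also have "|UNIV :: nat set set| \<le>o |UNIV :: (nat \<Rightarrow> 'f) set|"
    by (intro card_of_ordLeqI[of "\<lambda>A n. of_bool (n \<in> A)"])
      (auto simp: inj_def fun_eq_iff)
  finally show False
    using ordLess_irreflexive by blast
qed

text \<open>Connects cardinal exponentiation with binary sequences. \<open>Func\<close> fixes the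
  values outside the domain, but \<open>Field natLeq\<close> is the whole type, so no function is
  excluded.\<close>

lemma continuum_ordIso: "ctwo ^c natLeq =o |UNIV :: (nat \<Rightarrow> bit) set|"
proof -
  have "bij (\<lambda>(x :: nat \<Rightarrow> bool) n. of_bool (x n) :: bit)"
  proof (rule bijI)
    show "inj (\<lambda>(x :: nat \<Rightarrow> bool) n. of_bool (x n) :: bit)"
      by (simp add: inj_def fun_eq_iff) blast
    have "of_bool (y = 1) = y" for y :: bit
      by (cases y) auto
    then show "surj (\<lambda>(x :: nat \<Rightarrow> bool) n. of_bool (x n) :: bit)"
      by (intro surjI[of _ "\<lambda>y n. y n = 1"]) simp
  qed
  moreover have "Func (Field natLeq) (Field ctwo) = UNIV"
    by (auto simp: Func_def ctwo_def Field_natLeq Field_card_of)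
  ultimately show ?thesis
    unfolding cexp_def by (simp add: card_of_ordIsoI)
qed

lemma card_of_closedin_sequences_ordLeq:
  assumes "countable (UNIV :: 'f set)"
  shows "|{A. closedin (sequence_space :: (nat \<Rightarrow> 'f) topology) A}| \<le>o |UNIV :: (nat \<Rightarrow> bit) set|"
proof -
  let ?T = "sequence_space :: (nat \<Rightarrow> 'f) topology"
  obtain e :: "'f list \<Rightarrow> nat" where e: "inj e"
    using assms by (metis countableE countable_lists lists_UNIV)
  \<comment> \<open>a closed set is determined by the finite prefixes of its elements\<close>
  define G where "G A m = (if m \<in> e ` {map y [0..<n] | y n. y \<in> A} then 1 else 0 :: bit)"
    for A :: "(nat \<Rightarrow> 'f) set" and m
  have sub: "A \<subseteq> B" if B: "closedin ?T B" and eq: "G A = G B" for A B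
  proof (rule subsetI, rule ccontr)
    fix x assume x: "x \<in> A" "x \<notin> B"
    have "openin ?T (- B)"
      using B by (simp add: closedin_def PiE_UNIV_domain Compl_eq_Diff_UNIV)
    then obtain U where U: "finite {i. U i \<noteq> UNIV}" "x \<in> Pi\<^sub>E UNIV U" "Pi\<^sub>E UNIV U \<subseteq> - B"
      using x(2) unfolding openin_product_topology_alt by simp (metis ComplI)
    \<comment> \<open>The box \<open>U\<close> around \<open>x\<close> restricts only coordinates
      below \<open>n\<close>, so a member of \<open>B\<close> with the same prefix of length
      \<open>n\<close> would lie in this box, which is disjoint from \<open>B\<close>.\<close>
    obtain n where n: "\<forall>i\<in>{i. U i \<noteq> UNIV}. i < n"
      using U(1) finite_nat_set_iff_bounded by blast
    have "e (map x [0..<n]) \<in> e ` {map y [0..<n] | y n. y \<in> A}"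
      by (intro imageI CollectI exI conjI) (use x(1) in auto)
    then have "G B (e (map x [0..<n])) = 1"
      unfolding eq[symmetric] G_def by (rule if_P)
    then have "e (map x [0..<n]) \<in> e ` {map y [0..<n] | y n. y \<in> B}"
      unfolding G_def by (rule contrapos_pp) simp
    then obtain y m where y: "y \<in> B" "map x [0..<n] = map y [0..<m]"
      using e by (auto simp: inj_def)
    then have "m = n"
      by (metis diff_zero length_map length_upt)
    then have "y i = x i" if "i < n" for i
      using y(2) that by (metis atLeastLessThan_iff map_eq_conv set_upt zero_le)
    then have "y i \<in> U i" for i
      using U(2) n by (cases "U i = UNIV") (auto simp: PiE_iff)
    then show False
      using U(3) y(1) by (auto simp: PiE_iff)
  qed
  have "inj_on G {A. closedin ?T A}"
    by (rule inj_onI, rule equalityI) (simp_all add: sub)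
  then show ?thesis
    by (intro card_of_ordLeqI[of G]) auto
qed

section \<open>Partitions into infinitely many sets\<close>

lemma continuous_map_sequence_space_coordinate:
  "continuous_map sequence_space (discrete_topology UNIV) (\<lambda>x. h (x n))"
proof -
  have n: "continuous_map sequence_space (discrete_topology UNIV) (\<lambda>x. x n)"
    by (rule continuous_map_product_projection[of n UNIV "\<lambda>_. discrete_topology UNIV"]) simp
  have h: "continuous_map (discrete_topology UNIV) (discrete_topology UNIV) h"
    by simp
  show ?thesis
    using continuous_map_compose[OF n h] by (simp add: o_def)
qed

lemma homeomorphic_maps_translation:
  fixes a :: "nat \<Rightarrow> 'f::ab_group_add"
  shows "homeomorphic_maps sequence_space sequence_space (\<lambda>x. x + a) (\<lambda>x. x - a)"
proof -
  have "continuous_map sequence_space sequence_space (\<lambda>x. x + c)" for c :: "nat \<Rightarrow> 'f"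
    unfolding continuous_map_componentwise_UNIV plus_fun_apply
    by (intro allI continuous_map_sequence_space_coordinate[of "\<lambda>z. z + c n" n for n])
  from this[of a] this[of "- a"] show ?thesis
    by (simp add: homeomorphic_maps_def)
qed

text \<open>The linear construction for the coordinatewise vector space structure. Additivity is all
  that translating fibres requires, and for infinite \<open>S\<close> the span has the cardinality
  of \<open>S\<close>.\<close>

lemma sequence_space_linear_map:
  fixes S :: "(nat \<Rightarrow> 'f::field) set"
  assumes "countable (UNIV :: 'f set)" "infinite S"
  obtains f :: "(nat \<Rightarrow> 'f) \<Rightarrow> (nat \<Rightarrow> 'f)" where
    "\<And>x y. f (x + y) = f x + f y" "|range f| =o |S|" "S \<subseteq> range f"
    "\<And>C w. cantor_space (subtopology sequence_space C) \<Longrightarrow> w \<in> range f \<Longrightarrow> \<exists>x\<in>C. f x = w"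
proof -
  define s where "s c v n = c * v n" for c :: 'f and v :: "nat \<Rightarrow> 'f" and n :: nat
  interpret vector_space s
    by unfold_locales (auto simp: s_def fun_eq_iff algebra_simps)
  let ?T = "sequence_space :: (nat \<Rightarrow> 'f) topology"
  define \<C> where "\<C> = {C. cantor_space (subtopology ?T C)}"
  \<comment> \<open>Cantor subsets are compact, hence closed in this Hausdorff space, and closed
    sets number at most the continuum.\<close>
  have "|\<C>| \<le>o |{A. closedin ?T A}|"
  proof (rule card_of_mono1, rule subsetI, rule CollectI)
    fix C assume "C \<in> \<C>"
    then have "compactin ?T C"
      by (auto simp: \<C>_def cantor_space_def compactin_subspace PiE_UNIV_domain)
    then show "closedin ?T C"
      by (intro compactin_imp_closedin) (auto simp: Hausdorff_space_product_topology)
  qed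
  also have "|{A. closedin ?T A}| \<le>o |UNIV :: (nat \<Rightarrow> bit) set|"
    by (rule card_of_closedin_sequences_ordLeq[OF assms(1)])
  also note card_of_binary_sequences_ordLeq
  finally have \<C>: "|\<C>| \<le>o |UNIV :: (nat \<Rightarrow> 'f) set|" .
  have C: "|UNIV :: (nat \<Rightarrow> 'f) set| \<le>o |C|" if "C \<in> \<C>" for C
  proof -
    have "|C| =o |UNIV :: (nat \<Rightarrow> bit) set|"
      using card_of_cantor_space[of "subtopology ?T C"] that by (simp add: \<C>_def PiE_UNIV_domain)
    then show ?thesis
      using card_of_sequences_ordLeq[OF assms(1)] ordIso_symmetric ordLeq_ordIso_trans by blast
  qed
  obtain f where f: "Vector_Spaces.linear s s f" "range f = span S"
    "\<And>C w. C \<in> \<C> \<Longrightarrow> w \<in> span S \<Longrightarrow> \<exists>x\<in>C. f x = w"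
    using linear_map_fibres_meet[OF assms(1) uncountable_sequences \<C> C] by metis
  interpret f: Vector_Spaces.linear s s f
    by (fact f(1))
  have "|span S| \<le>o |S|"
    using assms by (intro card_of_span_ordLeq card_of_mono1) auto
  moreover have "S \<subseteq> span S"
    by (rule span_superset)
  ultimately show ?thesis
    using that[of f] f f.add card_of_mono1[of S "span S"]
    by (auto simp: \<C>_def ordIso_iff_ordLeq)
qed

text \<open>The bound by the continuum lets \<kappa> be embedded as a set \<open>S\<close> of
  vectors. Translation by \<open>b - a\<close> carries the fibre over \<open>f a\<close> onto the
  fibre over \<open>f b\<close>.\<close>

lemma partitionable_sequence_space_infinite:
  fixes \<kappa> :: "'k rel"
  assumes "countable (UNIV :: 'f::field set)" "Card_order \<kappa>" "infinite (Field \<kappa>)"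
    and "\<kappa> \<le>o ctwo ^c natLeq"
  shows "partitionable_homeomorphic_bernstein (sequence_space :: (nat \<Rightarrow> 'f) topology) \<kappa>"
proof -
  let ?T = "sequence_space :: (nat \<Rightarrow> 'f) topology"
  have "|Field \<kappa>| =o \<kappa>"
    using assms(2) by (rule card_of_Field_ordIso)
  also note assms(4)
  also note continuum_ordIso
  also note card_of_binary_sequences_ordLeq
  finally have "|Field \<kappa>| \<le>o |UNIV :: (nat \<Rightarrow> 'f) set|" .
  then obtain e :: "'k \<Rightarrow> nat \<Rightarrow> 'f" where e: "inj_on e (Field \<kappa>)"
    unfolding card_of_ordLeq[symmetric] by blast
  define S where "S = e ` Field \<kappa>"
  have "|Field \<kappa>| =o |S|"
    using e by (intro card_of_ordIsoI[of e]) (auto simp: S_def bij_betw_def)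
  then have S: "|S| =o \<kappa>"
    using card_of_Field_ordIso[OF assms(2)] ordIso_symmetric ordIso_transitive by blast
  have "infinite S"
    using e assms(3) by (simp add: S_def finite_image_iff)
  then obtain f :: "(nat \<Rightarrow> 'f) \<Rightarrow> (nat \<Rightarrow> 'f)" where add: "\<And>x y. f (x + y) = f x + f y"
    and card: "|range f| =o |S|" and "S \<subseteq> range f"
    and meets: "\<And>C w. cantor_space (subtopology ?T C) \<Longrightarrow> w \<in> range f \<Longrightarrow> \<exists>x\<in>C. f x = w"
    using sequence_space_linear_map[OF assms(1)] by metis
  obtain k0 where "k0 \<in> S"
    using \<open>infinite S\<close> by fastforce
  moreover obtain k1 where "k1 \<in> S - {k0}"
    using infinite_imp_nonempty[OF infinite_remove[OF \<open>infinite S\<close>, of k0]] by blast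
  ultimately have "k0 \<in> range f" "k1 \<in> range f" "k0 \<noteq> k1"
    using \<open>S \<subseteq> range f\<close> by auto
  then show ?thesis
  proof (rule partitionable_homeomorphic_bernsteinI[rotated])
    show "|range f| =o \<kappa>"
      using card S ordIso_transitive by blast
    show "f ` topspace ?T = range f"
      by (simp add: PiE_UNIV_domain)
    fix k l assume "k \<in> range f" "l \<in> range f"
    then obtain a b where ab: "k = f a" "l = f b" by blast
    have "f (x + (b - a)) = l" if "f x = k" for x
    proof -
      have "f b = f (b - a) + f a"
        using add[of "b - a" a] by simp
      then show ?thesis
        using that by (simp add: add ab)
    qed
    moreover have "f (x - (b - a)) = k" if "f x = l" for x
    proof -
      have "f b = f (b - a) + f a" "f x = f (x - (b - a)) + f (b - a)"
        using add[of "b - a" a] add[of "x - (b - a)" "b - a"] by simp_all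
      then show ?thesis
        using that by (simp add: ab)
    qed
    ultimately have "homeomorphic_maps (subtopology ?T {x \<in> topspace ?T. f x = k})
        (subtopology ?T {x \<in> topspace ?T. f x = l}) (\<lambda>x. x + (b - a)) (\<lambda>x. x - (b - a))"
      by (intro homeomorphic_maps_subtopologies_alt[OF homeomorphic_maps_translation])
        (auto simp: PiE_UNIV_domain)
    then show "subtopology ?T {x \<in> topspace ?T. f x = k} homeomorphic_space
        subtopology ?T {x \<in> topspace ?T. f x = l}"
      by (auto simp: homeomorphic_space_def)
  qed (use meets in auto)
qed

section \<open>Partitions into finitely many sets\<close>

lemma partitionable_finite_times_sequence_space:
  fixes \<kappa> :: "'k rel" and n :: nat
  assumes "countable (UNIV :: 'f::field set)" "2 \<le> n" "|{..<n}| =o \<kappa>"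
  shows "partitionable_homeomorphic_bernstein
    (prod_topology (discrete_topology {..<n}) (sequence_space :: (nat \<Rightarrow> 'f) topology)) \<kappa>"
proof -
  let ?T = "sequence_space :: (nat \<Rightarrow> 'f) topology"
  let ?Y = "prod_topology (discrete_topology {..<n}) ?T"
  have inf: "infinite (UNIV :: (nat \<Rightarrow> 'f) set)"
    using uncountable_sequences countable_finite by blast
  then obtain f :: "(nat \<Rightarrow> 'f) \<Rightarrow> (nat \<Rightarrow> 'f)" where "surj f"
    and meets: "\<And>C w. cantor_space (subtopology ?T C) \<Longrightarrow> w \<in> range f \<Longrightarrow> \<exists>x\<in>C. f x = w"
    using sequence_space_linear_map[OF assms(1), of UNIV] by (metis top.extremum_unique)
  obtain e :: "nat \<Rightarrow> nat \<Rightarrow> 'f" where e: "inj e"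
    using inf infinite_countable_subset by blast
  \<comment> \<open>A linear map need not admit exactly \<open>n\<close> fibres: over the rationals
    a finite range is trivial. So the values are collapsed: \<open>f\<close> attains each
    \<open>e k\<close> on every Cantor set, and there \<open>g\<close> equals \<open>k\<close> for
    \<open>k < n\<close>. Symmetry of the fibres is regained from the finite factor.\<close>
  define g where "g x = inv e (f x) mod n" for x
  have g: "\<exists>x\<in>C. g x = k" if C: "cantor_space (subtopology ?T C)" and "k < n" for C k
  proof -
    obtain x where "x \<in> C" "f x = e k"
      using meets[OF C, of "e k"] \<open>surj f\<close> by auto
    then show ?thesis
      using e \<open>k < n\<close> by (intro bexI[of _ x]) (simp_all add: g_def)
  qed
  define F where "F = (\<lambda>(i, x). (i + g x) mod n)"
  have F_meets: "\<exists>p\<in>C. F p = k" if C: "C \<subseteq> topspace ?Y" "cantor_space (subtopology ?Y C)" and "k < n" for C k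
  proof -
    have "C \<noteq> {}"
      using C by (auto simp: cantor_space_def)
    then obtain i x where ix: "(i, x) \<in> C" "i < n"
      using C(1) by auto
    \<comment> \<open>The slice over \<open>i\<close> is clopen in \<open>C\<close>, hence again a
      Cantor space, and on it the second projection is a homeomorphism onto
      \<open>E\<close>.\<close>
    define D where "D = C \<inter> {i} \<times> UNIV"
    define E where "E = snd ` D"
    have slice: "openin ?Y ({i} \<times> UNIV)" "closedin ?Y ({i} \<times> UNIV)"
      using ix(2) openin_topspace[of ?T] closedin_topspace[of ?T]
      by (auto simp: openin_prod_Times_iff closedin_prod_Times_iff PiE_UNIV_domain)
    have "cantor_space (subtopology (subtopology ?Y C) D)"
      using C(1) slice ix(1) unfolding D_def
      by (intro cantor_space_clopen_subtopology[OF C(2)] openin_subtopology_Int2 closedin_subtopology_Int_closed) auto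
    then have "cantor_space (subtopology ?Y D)"
      by (simp add: subtopology_subtopology D_def)
    moreover have "homeomorphic_maps (subtopology ?Y D) (subtopology ?T E) snd (Pair i)"
      unfolding homeomorphic_maps_def
    proof (intro conjI ballI)
      show "continuous_map (subtopology ?Y D) (subtopology ?T E) snd"
        using continuous_map_from_subtopology[OF continuous_map_snd[of "discrete_topology {..<n}" ?T], of D]
        by (auto simp: continuous_map_in_subtopology E_def)
      have "continuous_map ?T ?Y (Pair i)"
        using ix(2) by (auto simp: continuous_map_pairwise o_def)
      then show "continuous_map (subtopology ?T E) (subtopology ?Y D) (Pair i)"
        by (auto simp: continuous_map_in_subtopology continuous_map_from_subtopology E_def D_def)
    qed (auto simp: D_def)
    ultimately have "cantor_space (subtopology ?T E)"
      using homeomorphic_cantor_space homeomorphic_space_def by blast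
    \<comment> \<open>This value solves \<open>i + g y = k\<close> modulo \<open>n\<close>;
      \<open>n - i\<close> replaces \<open>- i\<close> in the naturals.\<close>
    then obtain y where y: "y \<in> E" "g y = (k + (n - i)) mod n"
      using g[of E "(k + (n - i)) mod n"] assms(2) by auto
    have "F (i, y) = (i + (k + (n - i))) mod n"
      by (simp add: F_def y mod_add_right_eq)
    also have "\<dots> = k"
      using ix(2) \<open>k < n\<close> by simp
    finally show ?thesis
      using y(1) by (auto simp: E_def D_def)
  qed
  have shift: "homeomorphic_maps ?Y ?Y (\<lambda>(i, x). ((i + d) mod n, x)) (\<lambda>(i, x). ((i + d') mod n, x))"
    if "(d + d') mod n = 0" for d d'
  proof -
    have "((i + d) mod n + d') mod n = i" "((i + d') mod n + d) mod n = i" if "i < n" for i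
      using \<open>(d + d') mod n = 0\<close> that
      by (metis add.assoc add.commute add.right_neutral mod_add_left_eq mod_add_right_eq mod_less)+
    then have "homeomorphic_maps (discrete_topology {..<n}) (discrete_topology {..<n})
        (\<lambda>i. (i + d) mod n) (\<lambda>i. (i + d') mod n)"
      using assms(2) by (auto simp: homeomorphic_maps_def)
    moreover have "homeomorphic_maps ?T ?T (\<lambda>x. x) (\<lambda>x. x)"
      by (simp add: homeomorphic_maps_def)
    ultimately show ?thesis
      unfolding homeomorphic_maps_prod by blast
  qed
  show ?thesis
  proof (rule partitionable_homeomorphic_bernsteinI[OF assms(3), of 0 1 F])
    show "F ` topspace ?Y = {..<n}"
    proof
      show "F ` topspace ?Y \<subseteq> {..<n}"
        using assms(2) by (auto simp: F_def)
      show "{..<n} \<subseteq> F ` topspace ?Y"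
      proof
        fix k assume "k \<in> {..<n}"
        moreover have "g (\<lambda>_. 0) < n"
          using assms(2) by (simp add: g_def)
        ultimately have "k = F ((k + (n - g (\<lambda>_. 0))) mod n, \<lambda>_. 0)"
          by (simp add: F_def mod_add_left_eq)
        then show "k \<in> F ` topspace ?Y"
          using assms(2) by (intro image_eqI[of _ _ "((k + (n - g (\<lambda>_. 0))) mod n, \<lambda>_. 0)"]) (auto simp: PiE_UNIV_domain)
      qed
    qed
    fix k l assume kl: "k \<in> {..<n}" "l \<in> {..<n}"
    \<comment> \<open>Rotation by \<open>d\<close> raises the value of \<open>F\<close> from
      \<open>k\<close> to \<open>l\<close> modulo \<open>n\<close>, and rotation by
      \<open>d'\<close> undoes this, as the two add up to \<open>n + n\<close>.\<close>
    define d d' where "d = l + (n - k)" and "d' = k + (n - l)"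
    have "d + d' = n + n"
      using kl by (simp add: d_def d'_def)
    then have dd: "(d + d') mod n = 0" by simp
    have F_d: "F ((i + d) mod n, x) = l" if "F (i, x) = k" for i x
    proof -
      have "F ((i + d) mod n, x) = ((i + g x) mod n + d) mod n"
        by (simp add: F_def mod_simps ac_simps)
      also have "(i + g x) mod n = k"
        using that by (simp add: F_def)
      also have "(k + d) mod n = l"
        using kl by (simp add: d_def)
      finally show ?thesis .
    qed
    have F_d': "F ((i + d') mod n, x) = k" if "F (i, x) = l" for i x
    proof -
      have "F ((i + d') mod n, x) = ((i + g x) mod n + d') mod n"
        by (simp add: F_def mod_simps ac_simps)
      also have "(i + g x) mod n = l"
        using that by (simp add: F_def)
      also have "(l + d') mod n = k"
        using kl by (simp add: d'_def)
      finally show ?thesis .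
    qed
    have "homeomorphic_maps (subtopology ?Y {p \<in> topspace ?Y. F p = k}) (subtopology ?Y {p \<in> topspace ?Y. F p = l})
        (\<lambda>(i, x). ((i + d) mod n, x)) (\<lambda>(i, x). ((i + d') mod n, x))"
      using F_d F_d' assms(2)
      by (intro homeomorphic_maps_subtopologies_alt[OF shift[OF dd]]) (auto simp: PiE_UNIV_domain)
    then show "subtopology ?Y {p \<in> topspace ?Y. F p = k} homeomorphic_space
        subtopology ?Y {p \<in> topspace ?Y. F p = l}"
      by (auto simp: homeomorphic_space_def)
  qed (use F_meets assms(2) in auto)
qed

text \<open>The finite index is absorbed into coordinate 0 by a bijection between
  \<open>{..<n} \<times> UNIV\<close> and the countably infinite alphabet; the other coordinates
  stay fixed.\<close>

lemma finite_times_sequence_space_homeomorphic: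
  fixes n :: nat
  assumes "0 < n" "countable (UNIV :: 'f set)" "infinite (UNIV :: 'f set)"
  shows "prod_topology (discrete_topology {..<n}) (sequence_space :: (nat \<Rightarrow> 'f) topology)
    homeomorphic_space (sequence_space :: (nat \<Rightarrow> 'f) topology)"
proof -
  let ?T = "sequence_space :: (nat \<Rightarrow> 'f) topology"
  let ?Y = "prod_topology (discrete_topology {..<n}) ?T"
  have "countable ({..<n} \<times> (UNIV :: 'f set))" "infinite ({..<n} \<times> (UNIV :: 'f set))"
    using assms by (auto simp: finite_cartesian_product_iff lessThan_empty_iff intro: countable_SIGMA)
  then obtain e :: "nat \<times> 'f \<Rightarrow> 'f" where e: "bij_betw e ({..<n} \<times> UNIV) UNIV"
    using assms by (metis bij_betw_from_nat_into bij_betw_inv_into bij_betw_trans)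
  define e' where "e' = inv_into ({..<n} \<times> UNIV) e"
  have e': "e' b \<in> {..<n} \<times> UNIV" "e (e' b) = b" for b
    using e by (auto simp: e'_def bij_betw_def inv_into_into f_inv_into_f)
  have e'_e: "e' (e p) = p" if "p \<in> {..<n} \<times> UNIV" for p
    using e that by (simp add: e'_def bij_betw_def)
  have "homeomorphic_maps ?Y ?T (\<lambda>(i, x). x(0 := e (i, x 0)))
      (\<lambda>y. (fst (e' (y 0)), y(0 := snd (e' (y 0)))))"
    unfolding homeomorphic_maps_def
  proof (intro conjI ballI)
    show "continuous_map ?Y ?T (\<lambda>(i, x). x(0 := e (i, x 0)))"
      unfolding continuous_map_componentwise_UNIV
    proof
      fix m :: nat
      have snd: "continuous_map ?Y (discrete_topology UNIV) (\<lambda>p. snd p m)"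
        using continuous_map_compose[OF continuous_map_snd continuous_map_sequence_space_coordinate[of id m]] by (simp add: o_def)
      have "continuous_map ?Y (discrete_topology ({..<n} \<times> UNIV)) (\<lambda>p. (fst p, snd p 0))"
        unfolding prod_topology_discrete_topology
        using continuous_map_compose[OF continuous_map_snd continuous_map_sequence_space_coordinate[of id 0]]
        by (auto simp: continuous_map_pairwise o_def intro: continuous_map_fst)
      moreover have "continuous_map (discrete_topology ({..<n} \<times> UNIV)) (discrete_topology UNIV) e"
        by simp
      ultimately have "continuous_map ?Y (discrete_topology UNIV) (e \<circ> (\<lambda>p. (fst p, snd p 0)))"
        by (rule continuous_map_compose)
      then show "continuous_map ?Y (discrete_topology UNIV) (\<lambda>p. (case p of (i, x) \<Rightarrow> x(0 := e (i, x 0))) m)"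
        using snd by (cases "m = 0") (simp_all add: case_prod_unfold o_def)
    qed
    have "continuous_map ?T (discrete_topology {..<n}) (\<lambda>y. fst (e' (y 0)))"
      using continuous_map_sequence_space_coordinate[of "\<lambda>b. fst (e' b)" 0] e'(1)
      by (auto simp: continuous_map_def mem_Times_iff)
    moreover have "continuous_map ?T ?T (\<lambda>y. y(0 := snd (e' (y 0))))"
      unfolding continuous_map_componentwise_UNIV
    proof
      fix m :: nat
      show "continuous_map ?T (discrete_topology UNIV) (\<lambda>y. (y(0 := snd (e' (y 0)))) m)"
        using continuous_map_sequence_space_coordinate[of "\<lambda>b. snd (e' b)" 0]
          continuous_map_sequence_space_coordinate[of id m] by (cases "m = 0") auto
    qed
    ultimately show "continuous_map ?T ?Y (\<lambda>y. (fst (e' (y 0)), y(0 := snd (e' (y 0)))))"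
      by (simp add: continuous_map_pairwise o_def)
  qed (auto simp: e' e'_e)
  then show ?thesis
    unfolding homeomorphic_space_def by blast
qed

theorem theorem7:
  fixes P :: "'a topology" and \<kappa> :: "'k rel"
  assumes "Card_order \<kappa>" and "ctwo \<le>o \<kappa>" and "\<kappa> \<le>o ctwo ^c natLeq"
  shows "(cantor_space P \<longrightarrow> partitionable_homeomorphic_bernstein P \<kappa>) \<and>
         partitionable_homeomorphic_bernstein baire_space \<kappa>"
proof -
  let ?Q = "sequence_space :: (nat \<Rightarrow> rat) topology"
  let ?C = "sequence_space :: (nat \<Rightarrow> bit) topology"
  have bit: "countable (UNIV :: bit set)"
  proof (rule countable_subset)
    show "(UNIV :: bit set) \<subseteq> {0, 1}"
      by (metis bit_not_one_iff insertCI subsetI)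
  qed simp
  have baire: "?Q homeomorphic_space baire_space"
    by (rule homeomorphic_space_sym[THEN iffD1, OF baire_space_homeomorphic_product])
      (simp_all add: infinite_UNIV_char_0)
  show ?thesis
  proof (cases "finite (Field \<kappa>)")
    case False
    have C: "partitionable_homeomorphic_bernstein ?C \<kappa>"
      by (rule partitionable_sequence_space_infinite[OF bit assms(1) False assms(3)])
    have "?C homeomorphic_space P" if "cantor_space P"
      by (rule homeomorphic_space_sym[THEN iffD1, OF cantor_space_homeomorphic_sequence_space[OF that]])
    then have "partitionable_homeomorphic_bernstein P \<kappa>" if "cantor_space P"
      by (rule homeomorphic_partitionable_homeomorphic_bernstein[OF _ C]) (rule that)
    moreover have "partitionable_homeomorphic_bernstein ?Q \<kappa>"
      by (rule partitionable_sequence_space_infinite[OF _ assms(1) False assms(3)]) simp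
    then have "partitionable_homeomorphic_bernstein baire_space \<kappa>"
      by (rule homeomorphic_partitionable_homeomorphic_bernstein[OF baire])
    ultimately show ?thesis by (intro conjI impI)
  next
    case True
    define n where "n = card (Field \<kappa>)"
    obtain b where "bij_betw b {..<n} (Field \<kappa>)"
      using True finite_same_card_bij[of "{..<n}" "Field \<kappa>"] by (auto simp: n_def)
    then have n: "|{..<n}| =o \<kappa>"
      using card_of_ordIsoI card_of_Field_ordIso[OF assms(1)] ordIso_transitive by blast
    \<comment> \<open>An embedding of the two truth values turns the lower bound on \<kappa> into
      \<open>2 \<le> n\<close>.\<close>
    have "|UNIV :: bool set| \<le>o |Field \<kappa>|"
      using assms(2) card_of_Field_ordIso[OF assms(1)] unfolding ctwo_def
      by (blast intro: ordIso_symmetric ordLeq_ordIso_trans)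
    then obtain c :: "bool \<Rightarrow> 'k" where "inj c" "range c \<subseteq> Field \<kappa>"
      unfolding card_of_ordLeq[symmetric] by blast
    then have "2 \<le> n"
      using card_inj_on_le[of c UNIV "Field \<kappa>"] True by (simp add: n_def card_UNIV_bool)
    have "partitionable_homeomorphic_bernstein P \<kappa>" if P: "cantor_space P"
    proof -
      let ?Y = "prod_topology (discrete_topology {..<n}) P"
      \<comment> \<open>With a two-element alphabet the finite index cannot be absorbed into one
        coordinate. Instead the product is itself a Cantor space, and all Cantor spaces are
        homeomorphic by the coding.\<close>
      have "cantor_space ?Y"
        using P \<open>2 \<le> n\<close> by (intro cantor_space_discrete_times) (auto simp: lessThan_empty_iff)
      then have "?Y homeomorphic_space ?C"
        by (rule cantor_space_homeomorphic_sequence_space)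
      also have "?C homeomorphic_space P"
        by (rule homeomorphic_space_sym[THEN iffD1, OF cantor_space_homeomorphic_sequence_space[OF P]])
      finally have "?Y homeomorphic_space P" .
      have "prod_topology (discrete_topology {..<n}) ?C homeomorphic_space ?Y"
        using \<open>?C homeomorphic_space P\<close>
        by (intro homeomorphic_space_prod_topology homeomorphic_space_refl)
      also note \<open>?Y homeomorphic_space P\<close>
      finally show ?thesis
        by (rule homeomorphic_partitionable_homeomorphic_bernstein)
          (rule partitionable_finite_times_sequence_space[OF bit \<open>2 \<le> n\<close> n])
    qed
    moreover have "prod_topology (discrete_topology {..<n}) ?Q homeomorphic_space ?Q"
      using \<open>2 \<le> n\<close>
      by (intro finite_times_sequence_space_homeomorphic) (simp_all add: infinite_UNIV_char_0)
    then have "prod_topology (discrete_topology {..<n}) ?Q homeomorphic_space baire_space"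
      using baire by (rule homeomorphic_space_trans)
    then have "partitionable_homeomorphic_bernstein baire_space \<kappa>"
      by (rule homeomorphic_partitionable_homeomorphic_bernstein)
        (rule partitionable_finite_times_sequence_space[OF _ \<open>2 \<le> n\<close> n], simp)
    ultimately show ?thesis by (intro conjI impI)
  qed
qed

end
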